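(* Assume that $$\lim_{M\to\infty}\ \limsup_{n\to\infty}\ \mathbf P_n\big(F\,1_{\{F\ge M\}}\big)=0,$$ and that, for every $\varepsilon>0$, the sequence $\big(N_{[]}(\varepsilon,\mathcal F,\|\cdot\|_{\mathbf P_{n,\beta_n},1})\big)_{n\ge1}$ is bounded in probability. Assume also that $\beta_n\in\ell^{1,+}$ almost surely for all $n\ge 1$, and that $(\|\beta_n\|_1)_{n\ge1}$ is bounded in probability. Then, under the condition $\|\beta_n\|_2\to0$ in probability, we have $\|G_n\|_{\mathcal F}\to0$ in probability as $n\to\infty$.
   Context: Notation. $\mathbb N=\{0,1,2,\dots\}$, $\mathbb N^*=\{1,2,\dots\}$. For a real sequence $p=(p_i)_{i\in\mathbb N}$, $\|p\|_r=(\sum_i|p_i|^r)^{1/r}$ for $1\le r<\infty$ and $\|p\|_\infty=\sup_i|p_i|$; $\ell^1=\{p:\|p\|_1<\infty\}$ and $\ell^{1,+}=\ell^1\cap[0,\infty)^{\mathbb N}$. For a measure $Q$, $Q(f)=\int f\,dQ$ and $\|f\|_{Q,r}=(Q(|f|^r))^{1/r}$. Probability space. $(\mathfrak X,\mathcal A_{\mathfrak X})$ is a measurable space. For each $n\ge1$, $\{\mathbf P_{n,p}:p\in\ell^1\}$ is a Markov transition kernel from $\ell^1$ (with its Borel $\sigma$-algebra) to $\mathfrak X$, and $Q_n$ is a Borel probability measure on $\ell^1$. Let $(\Omega,\mathcal A,\mathbb P)$ be the product over $n\ge1$ of the spaces $\ell^1\times\mathfrak X^{\mathbb N}$ (with product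 $\sigma$-algebras), where the law on the $n$-th factor is determined by $\mathbb P_n(\{(p,y):p\in A,\ y_j\in B_j,\ j=1,\dots,k\})=\int_A\prod_{j=1}^k\mathbf P_{n,p}(B_j)\,dQ_n(p)$ (and likewise for any finite set of coordinates). The coordinate maps are $\beta_n=(\beta_{i,n})_{i\in\mathbb N}$ ($\ell^1$-valued) and $Y_n=(Y_{i,n})_{i\in\mathbb N}$; thus $\beta_n\sim Q_n$ and, given $\beta_n=p$, the $Y_{i,n}$ are i.i.d. with law $\mathbf P_{n,p}$. $\mathbf P_n$ denotes the law of $Y_{1,n}$. $\mathbb E^*,\mathbb P^*$ denote outer expectation and outer probability. Class of functions. $\mathcal F$ is a class of real Borel (measurable) functions on $\mathfrak X$ that is pointwise measurable with countable separant $\mathcal F_0\subset\mathcal F$: every $f\in\mathcal F$ is the pointwise limit of a sequence in $\mathcal F_0$. $F(y)=\sup_{f\in\mathcal F}|f(y)|$ is its envelope, and it is assumed that $\mathbf P_n(F)<\infty$ for all $n\ge1$. For $\psi:\mathcal F\to\mathbb R$, $\|\psi\|_{\mathcal F}=\sup_{f\in\mathcal F}|\psi(f)|$. Bracketing numbers. The bracket $[f^-,f^+]$ between two real Borel functions is the set of Borel functions $f$ with $f^-\le f\le f^+$ everywhere; its $\|\cdot\|$-diameter is $\|f^+-f^-\|$. $N_{[]}(\varepsilon,\mathcal F,\|\cdot\|)$ is the minimal number of brackets with $\|\cdot\|$-diameter less than $\varepsilon$ needed to cover $\mathcal F$. Process $G_n$. For $M>0$ and $f\in\mathcal F$ let $$G_n^M(f)=\sum_{i\in\mathbb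 N}\beta_{i,n}\Big[(f1_{\{F\le M\}})(Y_{i,n})-\mathbf P_{n,\beta_n}(f1_{\{F\le M\}})\Big].$$ $G_n$ is the limit of $G_n^M$ as $M\to\infty$ for $\|\cdot\|_{\mathcal F}$-convergence in probability, i.e. the map from $\Omega$ to the bounded functions on $\mathcal F$ (unique up to $\mathbb P$-a.s. equality in $\|\cdot\|_{\mathcal F}$) such that $\mathbb E^*[\arctan\|G_n^M-G_n\|_{\mathcal F}]\to0$ as $M\to\infty$. Such a limit always exists under the standing assumptions that $\mathcal F$ is pointwise measurable with countable separant $\mathcal F_0$ and that $\mathbf P_n(F)<\infty$ for all $n\ge1$. A sequence $(Z_n)$ is bounded in probability if $\lim_{K\to\infty}\limsup_n\mathbb P(|Z_n|>K)=0$. *)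

theory Defs
  imports "HOL-Probability.Probability"
begin

subsection \<open>Sequence spaces\<close>

definition seq_norm :: "real \<Rightarrow> (nat \<Rightarrow> real) \<Rightarrow> real" where
  "seq_norm r p = (\<Sum>i. \<bar>p i\<bar> powr r) powr (1 / r)"

definition l1 :: "(nat \<Rightarrow> real) set" where
  "l1 = {p. summable (\<lambda>i. \<bar>p i\<bar>)}"

definition l1_pos :: "(nat \<Rightarrow> real) set" where
  "l1_pos = {p \<in> l1. \<forall>i. 0 \<le> p i}"

definition l1_dist :: "(nat \<Rightarrow> real) \<Rightarrow> (nat \<Rightarrow> real) \<Rightarrow> real" where
  "l1_dist p q = seq_norm 1 (\<lambda>i. p i - q i)"

lemma Metric_space_l1: "Metric_space l1 l1_dist"
proof
  have summ: "summable (\<lambda>i. \<bar>p i - q i\<bar>)" if "p \<in> l1" "q \<in> l1" for p q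
  proof (rule summable_comparison_test')
    show "summable (\<lambda>i. \<bar>p i\<bar> + \<bar>q i\<bar>)"
      using that unfolding l1_def by (intro summable_add) auto
    show "norm \<bar>p i - q i\<bar> \<le> \<bar>p i\<bar> + \<bar>q i\<bar>" if "i \<ge> 0" for i
      by simp
  qed
  have l1_dist: "l1_dist p q = (\<Sum>i. \<bar>p i - q i\<bar>)" if "p \<in> l1" "q \<in> l1" for p q
    using suminf_nonneg[OF summ[OF that]] by (simp add: l1_dist_def seq_norm_def)
  show "0 \<le> l1_dist x y" for x y
    by (simp add: l1_dist_def seq_norm_def)
  show "l1_dist x y = l1_dist y x" for x y
    by (simp add: l1_dist_def seq_norm_def abs_minus_commute)
  show "l1_dist x y = 0 \<longleftrightarrow> x = y" if "x \<in> l1" "y \<in> l1" for x y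
    using suminf_eq_zero_iff[OF summ[OF that]] by (simp add: l1_dist[OF that] fun_eq_iff)
  show "l1_dist x z \<le> l1_dist x y + l1_dist y z" if "x \<in> l1" "y \<in> l1" "z \<in> l1" for x y z
  proof -
    have "(\<Sum>i. \<bar>x i - z i\<bar>) \<le> (\<Sum>i. \<bar>x i - y i\<bar> + \<bar>y i - z i\<bar>)"
      using that by (intro suminf_le summable_add summ) auto
    also have "\<dots> = (\<Sum>i. \<bar>x i - y i\<bar>) + (\<Sum>i. \<bar>y i - z i\<bar>)"
      using that by (intro suminf_add[symmetric] summ)
    finally show ?thesis
      using that by (simp add: l1_dist)
  qed
qed

definition l1_borel :: "(nat \<Rightarrow> real) measure" where
  "l1_borel = sigma l1 {U. openin (Metric_space.mtopology l1 l1_dist) U}"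

lemma space_l1_borel [simp]: "space l1_borel = l1"
  by (simp add: l1_borel_def space_measure_of_conv)

lemma sets_l1_borel: "sets l1_borel = sigma_sets l1 {U. openin (Metric_space.mtopology l1 l1_dist) U}"
proof -
  have "U \<subseteq> l1" if "openin (Metric_space.mtopology l1 l1_dist) U" for U
    using openin_subset[OF that] by (simp add: Metric_space.topspace_mtopology[OF Metric_space_l1])
  then show ?thesis
    unfolding l1_borel_def by (intro sets_measure_of) blast
qed


subsection \<open>The probability space\<close>

text \<open>
  The law of \<open>(p, y)\<close> where \<open>p\<close> has law \<open>Q\<close> and, given \<open>p\<close>, the \<open>y\<^sub>j\<close> are i.i.d. with law \<open>\<kappa> p\<close>.
  It is characterised by its values on rectangles, see \<open>emeasure_factor_law\<close> below.
\<close>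

definition factor_law ::
  "'a measure \<Rightarrow> ((nat \<Rightarrow> real) \<Rightarrow> 'a measure) \<Rightarrow> (nat \<Rightarrow> real) measure
    \<Rightarrow> ((nat \<Rightarrow> real) \<times> (nat \<Rightarrow> 'a)) measure" where
  "factor_law X \<kappa> Q =
     Q \<bind> (\<lambda>p. distr (Pi\<^sub>M UNIV (\<lambda>_. \<kappa> p)) (l1_borel \<Otimes>\<^sub>M Pi\<^sub>M UNIV (\<lambda>_. X)) (Pair p))"

text \<open>Both \<open>\<kappa>\<close> and \<open>Q\<close> are indexed by \<open>n \<ge> 1\<close>; their values at \<open>0\<close> are irrelevant.\<close>

definition array_space ::
  "'a measure \<Rightarrow> (nat \<Rightarrow> (nat \<Rightarrow> real) \<Rightarrow> 'a measure) \<Rightarrow> (nat \<Rightarrow> (nat \<Rightarrow> real) measure)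
    \<Rightarrow> (nat \<Rightarrow> (nat \<Rightarrow> real) \<times> (nat \<Rightarrow> 'a)) measure" where
  "array_space X \<kappa> Q = Pi\<^sub>M {1..} (\<lambda>n. factor_law X (\<kappa> n) (Q n))"

definition beta :: "nat \<Rightarrow> (nat \<Rightarrow> (nat \<Rightarrow> real) \<times> (nat \<Rightarrow> 'a)) \<Rightarrow> nat \<Rightarrow> real" where
  "beta n \<omega> = fst (\<omega> n)"

definition obs :: "nat \<Rightarrow> nat \<Rightarrow> (nat \<Rightarrow> (nat \<Rightarrow> real) \<times> (nat \<Rightarrow> 'a)) \<Rightarrow> 'a" where
  "obs i n \<omega> = snd (\<omega> n) i"

definition marginal_law ::
  "'a measure \<Rightarrow> (nat \<Rightarrow> (nat \<Rightarrow> real) \<Rightarrow> 'a measure) \<Rightarrow> (nat \<Rightarrow> (nat \<Rightarrow> real) measure)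
    \<Rightarrow> nat \<Rightarrow> 'a measure" where
  "marginal_law X \<kappa> Q n = distr (array_space X \<kappa> Q) X (obs 1 n)"

lemma measurable_iid_kernel:
  assumes \<kappa>: "\<kappa> \<in> l1_borel \<rightarrow>\<^sub>M prob_algebra X"
  shows "(\<lambda>p. distr (Pi\<^sub>M UNIV (\<lambda>_. \<kappa> p)) (l1_borel \<Otimes>\<^sub>M Pi\<^sub>M UNIV (\<lambda>_. X)) (Pair p))
    \<in> l1_borel \<rightarrow>\<^sub>M prob_algebra (l1_borel \<Otimes>\<^sub>M Pi\<^sub>M (UNIV :: nat set) (\<lambda>_. X))"
proof (rule measurable_distr_prob_space2)
  have prob: "prob_space (\<kappa> p)" and sets: "sets (\<kappa> p) = sets X" if "p \<in> l1" for p
    using measurable_space[OF \<kappa>, of p] that by (auto simp: space_prob_algebra)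
  show "(\<lambda>p. Pi\<^sub>M UNIV (\<lambda>_. \<kappa> p)) \<in> l1_borel \<rightarrow>\<^sub>M prob_algebra (Pi\<^sub>M (UNIV :: nat set) (\<lambda>_. X))"
  proof (rule measurable_prob_algebra_generated[OF sets_PiM Int_stable_prod_algebra
        prod_algebra_sets_into_space])
    fix p assume p: "p \<in> space l1_borel"
    show "prob_space (Pi\<^sub>M (UNIV :: nat set) (\<lambda>_. \<kappa> p))"
      using prob p by (intro prob_space_PiM) auto
    show "sets (Pi\<^sub>M (UNIV :: nat set) (\<lambda>_. \<kappa> p)) = sets (Pi\<^sub>M (UNIV :: nat set) (\<lambda>_. X))"
      using sets p by (intro sets_PiM_cong) auto
  next
    fix A assume "A \<in> prod_algebra (UNIV :: nat set) (\<lambda>_. X)"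
    then obtain J E where J: "finite J" and E: "\<And>j. j \<in> J \<Longrightarrow> E j \<in> sets X"
      and A: "A = prod_emb UNIV (\<lambda>_. X) J (Pi\<^sub>E J E)"
      by (elim prod_algebraE) auto
    have "emeasure (Pi\<^sub>M UNIV (\<lambda>_. \<kappa> p)) A = (\<Prod>j\<in>J. emeasure (\<kappa> p) (E j))"
      if p: "p \<in> space l1_borel" for p
    proof -
      interpret product_prob_space "\<lambda>_. \<kappa> p" "UNIV :: nat set"
        using prob p by (intro product_prob_spaceI) auto
      have "A = prod_emb UNIV (\<lambda>_. \<kappa> p) J (Pi\<^sub>E J E)"
        unfolding A prod_emb_def using sets_eq_imp_space_eq[OF sets] p by auto
      then show ?thesis
        using J E sets p by (auto intro!: emeasure_PiM_emb)
    qed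
    moreover have "(\<lambda>p. \<Prod>j\<in>J. emeasure (\<kappa> p) (E j)) \<in> borel_measurable l1_borel"
      using \<kappa> E
      by (intro borel_measurable_prod_ennreal
          measurable_emeasure_kernel[OF measurable_prob_algebraD[OF \<kappa>]])
    ultimately show "(\<lambda>p. emeasure (Pi\<^sub>M UNIV (\<lambda>_. \<kappa> p)) A) \<in> borel_measurable l1_borel"
      by (subst measurable_cong)
  qed
qed simp

lemma emeasure_factor_law:
  assumes \<kappa>: "\<kappa> \<in> l1_borel \<rightarrow>\<^sub>M prob_algebra X"
    and Q: "prob_space Q" "sets Q = sets l1_borel"
    and A: "A \<in> sets l1_borel" and J: "finite J" and B: "\<And>j. j \<in> J \<Longrightarrow> B j \<in> sets X"
  shows "sets (factor_law X \<kappa> Q) = sets (l1_borel \<Otimes>\<^sub>M Pi\<^sub>M UNIV (\<lambda>_. X))"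
    and "prob_space (factor_law X \<kappa> Q)"
    and "emeasure (factor_law X \<kappa> Q)
           {(p, y) \<in> space (l1_borel \<Otimes>\<^sub>M Pi\<^sub>M UNIV (\<lambda>_. X)). p \<in> A \<and> (\<forall>j\<in>J. y j \<in> B j)}
         = (\<integral>\<^sup>+p\<in>A. (\<Prod>j\<in>J. emeasure (\<kappa> p) (B j)) \<partial>Q)"
proof -
  let ?L = "l1_borel \<Otimes>\<^sub>M Pi\<^sub>M (UNIV :: nat set) (\<lambda>_. X)"
  let ?R = "{(p, y) \<in> space ?L. p \<in> A \<and> (\<forall>j\<in>J. y j \<in> B j)}"
  note K = measurable_iid_kernel[OF \<kappa>]
  have Q': "Q \<in> space (prob_algebra l1_borel)"
    using Q by (simp add: space_prob_algebra)
  show "sets (factor_law X \<kappa> Q) = sets ?L" "prob_space (factor_law X \<kappa> Q)"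
    unfolding factor_law_def using sets_bind'[OF Q' K] prob_space_bind'[OF Q' K] by auto
  have "?R = {z \<in> space ?L. fst z \<in> A \<and> (\<forall>j\<in>J. snd z j \<in> B j)}"
    by auto
  also have "\<dots> \<in> sets ?L"
  proof -
    have "Measurable.pred ?L (\<lambda>z. snd z j \<in> B j)" if "j \<in> J" for j
      using B[OF that] by measurable
    with A J show ?thesis by measurable
  qed
  finally have R: "?R \<in> sets ?L" .
  have "emeasure (factor_law X \<kappa> Q) ?R
    = (\<integral>\<^sup>+p. emeasure (distr (Pi\<^sub>M UNIV (\<lambda>_. \<kappa> p)) ?L (Pair p)) ?R \<partial>Q)"
    unfolding factor_law_def by (rule emeasure_bind_prob_algebra[OF Q' K R])
  also have "\<dots> = (\<integral>\<^sup>+p\<in>A. (\<Prod>j\<in>J. emeasure (\<kappa> p) (B j)) \<partial>Q)"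
  proof (rule nn_integral_cong)
    fix p assume "p \<in> space Q"
    then have p: "p \<in> space l1_borel"
      using sets_eq_imp_space_eq[OF Q(2)] by simp
    then have \<kappa>p: "prob_space (\<kappa> p)" "sets (\<kappa> p) = sets X"
      using measurable_space[OF \<kappa>, of p] by (auto simp: space_prob_algebra)
    interpret product_prob_space "\<lambda>_. \<kappa> p" "UNIV :: nat set"
      using \<kappa>p by (intro product_prob_spaceI) auto
    have sets_P: "sets (Pi\<^sub>M (UNIV :: nat set) (\<lambda>_. \<kappa> p)) = sets (Pi\<^sub>M UNIV (\<lambda>_. X))"
      using \<kappa>p by (intro sets_PiM_cong) auto
    note space_P = sets_eq_imp_space_eq[OF sets_P]
    have meas: "Pair p \<in> Pi\<^sub>M UNIV (\<lambda>_. \<kappa> p) \<rightarrow>\<^sub>M ?L"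
      using p by (simp add: measurable_cong_sets[OF sets_P refl])
    have "emeasure (distr (Pi\<^sub>M UNIV (\<lambda>_. \<kappa> p)) ?L (Pair p)) ?R
      = emeasure (Pi\<^sub>M UNIV (\<lambda>_. \<kappa> p)) (Pair p -` ?R \<inter> space (Pi\<^sub>M UNIV (\<lambda>_. \<kappa> p)))"
      by (rule emeasure_distr[OF meas R])
    also have "Pair p -` ?R \<inter> space (Pi\<^sub>M UNIV (\<lambda>_. \<kappa> p))
      = (if p \<in> A then {y \<in> space (Pi\<^sub>M UNIV (\<lambda>_. \<kappa> p)). \<forall>j\<in>J. y j \<in> B j} else {})"
      using p by (auto simp: space_pair_measure space_P)
    also have "emeasure (Pi\<^sub>M UNIV (\<lambda>_. \<kappa> p)) \<dots>
      = (\<Prod>j\<in>J. emeasure (\<kappa> p) (B j)) * indicator A p"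
      using emeasure_PiM_Collect[of J B] J B \<kappa>p by auto
    finally show "emeasure (distr (Pi\<^sub>M UNIV (\<lambda>_. \<kappa> p)) ?L (Pair p)) ?R
      = (\<Prod>j\<in>J. emeasure (\<kappa> p) (B j)) * indicator A p" .
  qed
  finally show "emeasure (factor_law X \<kappa> Q) ?R
    = (\<integral>\<^sup>+p\<in>A. (\<Prod>j\<in>J. emeasure (\<kappa> p) (B j)) \<partial>Q)" .
qed


subsection \<open>Outer expectation and convergence in probability\<close>

text \<open>
  Outer expectation is spelled out because \<open>nn_integral\<close> of a non-measurable function is its
  lower integral.
\<close>

definition outer_expectation :: "'w measure \<Rightarrow> ('w \<Rightarrow> ennreal) \<Rightarrow> ennreal" where
  "outer_expectation P Z =
     (INF U \<in> {U \<in> borel_measurable P. \<forall>\<omega>\<in>space P. Z \<omega> \<le> U \<omega>}. \<integral>\<^sup>+\<omega>. U \<omega> \<partial>P)"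

text \<open>
  The two notions below are stated with outer probability, so that they apply to possibly
  non-measurable variables; for measurable ones they are the usual notions.
\<close>

definition bounded_in_prob :: "'w measure \<Rightarrow> (nat \<Rightarrow> 'w \<Rightarrow> ennreal) \<Rightarrow> bool" where
  "bounded_in_prob P Z \<longleftrightarrow>
     ((\<lambda>K. limsup (\<lambda>n. outer_measure_of P {\<omega> \<in> space P. Z n \<omega> > ennreal K})) \<longlongrightarrow> 0) at_top"

definition tendsto_zero_in_prob :: "'w measure \<Rightarrow> (nat \<Rightarrow> 'w \<Rightarrow> ennreal) \<Rightarrow> bool" where
  "tendsto_zero_in_prob P Z \<longleftrightarrow>
     (\<forall>\<epsilon>>0. (\<lambda>n. outer_measure_of P {\<omega> \<in> space P. Z n \<omega> > ennreal \<epsilon>}) \<longlonglongrightarrow> 0)"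


subsection \<open>Classes of functions and bracketing numbers\<close>

definition pointwise_measurable :: "'a measure \<Rightarrow> ('a \<Rightarrow> real) set \<Rightarrow> ('a \<Rightarrow> real) set \<Rightarrow> bool" where
  "pointwise_measurable X F F0 \<longleftrightarrow>
     F \<subseteq> borel_measurable X \<and> F0 \<subseteq> F \<and> countable F0 \<and>
     (\<forall>f\<in>F. \<exists>g. (\<forall>k. g k \<in> F0) \<and> (\<forall>x\<in>space X. (\<lambda>k. g k x) \<longlonglongrightarrow> f x))"

definition envelope :: "('a \<Rightarrow> real) set \<Rightarrow> 'a \<Rightarrow> ennreal" where
  "envelope F y = (SUP f\<in>F. ennreal \<bar>f y\<bar>)"

definition sup_norm :: "('a \<Rightarrow> real) set \<Rightarrow> (('a \<Rightarrow> real) \<Rightarrow> real) \<Rightarrow> ennreal" where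
  "sup_norm F \<psi> = (SUP f\<in>F. ennreal \<bar>\<psi> f\<bar>)"

definition L1_norm :: "'a measure \<Rightarrow> ('a \<Rightarrow> real) \<Rightarrow> ennreal" where
  "L1_norm Q f = (\<integral>\<^sup>+x. ennreal \<bar>f x\<bar> \<partial>Q)"

definition bracket :: "'a measure \<Rightarrow> ('a \<Rightarrow> real) \<Rightarrow> ('a \<Rightarrow> real) \<Rightarrow> ('a \<Rightarrow> real) set" where
  "bracket X l u = {f \<in> borel_measurable X. \<forall>x\<in>space X. l x \<le> f x \<and> f x \<le> u x}"

text \<open>The value is \<open>\<infinity>\<close> when no finite family of such brackets covers \<open>F\<close>.\<close>

definition bracketing_number ::
  "'a measure \<Rightarrow> real \<Rightarrow> ('a \<Rightarrow> real) set \<Rightarrow> (('a \<Rightarrow> real) \<Rightarrow> ennreal) \<Rightarrow> enat" where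
  "bracketing_number X \<epsilon> F nrm =
     Inf {enat (card S) | S. finite S \<and>
            (\<forall>(l, u)\<in>S. l \<in> borel_measurable X \<and> u \<in> borel_measurable X \<and>
               nrm (\<lambda>x. u x - l x) < ennreal \<epsilon>) \<and>
            F \<subseteq> (\<Union>(l, u)\<in>S. bracket X l u)}"


subsection \<open>The processes\<close>

definition truncated :: "('a \<Rightarrow> real) set \<Rightarrow> real \<Rightarrow> ('a \<Rightarrow> real) \<Rightarrow> 'a \<Rightarrow> real" where
  "truncated F M f y = f y * indicator {y. envelope F y \<le> ennreal M} y"

definition G_trunc ::
  "(nat \<Rightarrow> (nat \<Rightarrow> real) \<Rightarrow> 'a measure) \<Rightarrow> ('a \<Rightarrow> real) set \<Rightarrow> real \<Rightarrow> nat
    \<Rightarrow> (nat \<Rightarrow> (nat \<Rightarrow> real) \<times> (nat \<Rightarrow> 'a)) \<Rightarrow> ('a \<Rightarrow> real) \<Rightarrow> real" where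
  "G_trunc \<kappa> F M n \<omega> f =
     (\<Sum>i. beta n \<omega> i *
        (truncated F M f (obs i n \<omega>) - (\<integral>y. truncated F M f y \<partial>\<kappa> n (beta n \<omega>))))"

definition arctan_ennreal :: "ennreal \<Rightarrow> ennreal" where
  "arctan_ennreal z = (if z = \<infinity> then ennreal (pi / 2) else ennreal (arctan (enn2real z)))"

text \<open>
  \<open>G\<close> is a version of the process \<open>G\<^sub>n\<close>, which is determined up to almost sure equality only.
\<close>

definition is_G ::
  "'a measure \<Rightarrow> (nat \<Rightarrow> (nat \<Rightarrow> real) \<Rightarrow> 'a measure) \<Rightarrow> (nat \<Rightarrow> (nat \<Rightarrow> real) measure)
    \<Rightarrow> ('a \<Rightarrow> real) set \<Rightarrow> nat
    \<Rightarrow> ((nat \<Rightarrow> (nat \<Rightarrow> real) \<times> (nat \<Rightarrow> 'a)) \<Rightarrow> ('a \<Rightarrow> real) \<Rightarrow> real) \<Rightarrow> bool" where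
  "is_G X \<kappa> Q F n G \<longleftrightarrow>
     (\<forall>\<omega>\<in>space (array_space X \<kappa> Q). \<exists>C. \<forall>f\<in>F. \<bar>G \<omega> f\<bar> \<le> C) \<and>
     ((\<lambda>M. outer_expectation (array_space X \<kappa> Q)
              (\<lambda>\<omega>. arctan_ennreal (sup_norm F (\<lambda>f. G_trunc \<kappa> F M n \<omega> f - G \<omega> f)))) \<longlongrightarrow> 0) at_top"

end

theory Submission
  imports Defs
begin

text \<open>
  Write \<open>\<P>\<close> for the probability measure of the array, and let \<open>G\<^sup>M\<close> denote the process built from the
  functions truncated where the envelope exceeds \<open>M\<close>. The theorem is a uniform law of large numbers
  for weighted i.i.d. sums, proved by bracketing, conditionally on the weights.

  Fix the weights \<open>p \<ge> 0\<close>. A weighted sum of independent centred variables bounded by \<open>M\<close> has second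
  moment at most a constant times \<open>M\<^sup>2\<close> times the squared \<open>l\<^sup>2\<close> norm of \<open>p\<close>, so a single truncated
  function is controlled by Chebyshev's inequality (\<open>centred_sum_Chebyshev\<close>). Because the weights are
  nonnegative, the process at a function is sandwiched between its values at the endpoints of a
  bracket, up to the total weight times the size of the bracket. If the latter is small and the
  number \<open>K\<close> of brackets is bounded, the supremum over the whole class costs only a factor \<open>2 * K\<close>
  in the probability (\<open>maximal_inequality\<close>), which a small \<open>l\<^sup>2\<close> norm absorbs.

  The change of the process when the truncation level is raised above \<open>M\<close> is dominated, for the whole
  class at once, by a weighted sum of the part of the envelope at or above \<open>M\<close>
  (\<open>truncation_change_le_excess\<close>). Its conditional expectation is at most twice the total weight times
  a tail integral of the envelope; after integration over the weights the uniform tail condition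
  makes it small. The bound is the same for all higher levels, so it extends to the limit \<open>G\<close>.

  To combine the two parts one integrates over the weights that satisfy the bounds on the norms and on
  the bracketing number. The set of these weights need not be measurable, but only the points where
  one measurable function of the weights exceeds another have to be discarded
  (\<open>conditional_bound\<close>). The result for one row is \<open>row_estimate\<close>. The constants are then chosen in
  the order: bound on the total weight, truncation level, bracket size, number of brackets, and
  finally bound on the \<open>l\<^sup>2\<close> norm.
\<close>

section \<open>Summable weights\<close>

lemma l1_posD: "p \<in> l1_pos \<Longrightarrow> p \<in> l1" "p \<in> l1_pos \<Longrightarrow> 0 \<le> p i" "p \<in> l1_pos \<Longrightarrow> summable p"
  unfolding l1_pos_def l1_def by (auto simp: summable_rabs_cancel)

text \<open>
  The terms of a summable sequence are eventually below 1 in absolute value, and there the square is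
  the smaller of the two.
\<close>

lemma l1_square_summable:
  assumes "p \<in> l1"
  shows "summable (\<lambda>i. (p i)\<^sup>2)"
proof -
  have s: "summable (\<lambda>i. \<bar>p i\<bar>)" using assms by (simp add: l1_def)
  have "eventually (\<lambda>i. \<bar>p i\<bar> < 1) sequentially"
    using summable_LIMSEQ_zero[OF s] by (rule order_tendstoD) simp
  then have "eventually (\<lambda>i. norm ((p i)\<^sup>2) \<le> \<bar>p i\<bar>) sequentially"
  proof eventually_elim
    case (elim i)
    then have "\<bar>p i\<bar> * \<bar>p i\<bar> \<le> \<bar>p i\<bar> * 1" by (intro mult_left_mono) auto
    then show ?case by (simp add: power2_eq_square abs_mult)
  qed
  then show ?thesis by (rule summable_comparison_test_ev[OF _ s])
qed

lemma seq_norm_1_l1_pos: "p \<in> l1_pos \<Longrightarrow> seq_norm 1 p = suminf p"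
  using l1_posD[of p] suminf_nonneg[of p] by (simp add: seq_norm_def)

lemma seq_norm_2_l1: "p \<in> l1 \<Longrightarrow> (seq_norm 2 p)\<^sup>2 = (\<Sum>i. (p i)\<^sup>2)"
  using suminf_nonneg[OF l1_square_summable[of p]]
  by (simp add: seq_norm_def powr_half_sqrt)

section \<open>Weighted sums of independent centred variables\<close>

lemma nn_integral_iid_coordinate:
  assumes "prob_space D" "f \<in> borel_measurable D"
  shows "(\<integral>\<^sup>+y. f (y (i::nat)) \<partial>Pi\<^sub>M UNIV (\<lambda>_. D)) = (\<integral>\<^sup>+x. f x \<partial>D)"
proof -
  have "(\<integral>\<^sup>+x. f x \<partial>D) = (\<integral>\<^sup>+x. f x \<partial>distr (Pi\<^sub>M (UNIV::nat set) (\<lambda>_. D)) D (\<lambda>y. y i))"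
    using assms by (subst distr_PiM_component[where M="\<lambda>_. D"]) auto
  also have "\<dots> = (\<integral>\<^sup>+y. f (y i) \<partial>Pi\<^sub>M UNIV (\<lambda>_. D))"
    using assms by (subst nn_integral_distr) auto
  finally show ?thesis ..
qed

lemma integral_iid_coordinate:
  fixes f :: "'a \<Rightarrow> real"
  assumes "prob_space D" "f \<in> borel_measurable D"
  shows "(\<integral>y. f (y (i::nat)) \<partial>Pi\<^sub>M UNIV (\<lambda>_. D)) = (\<integral>x. f x \<partial>D)"
proof -
  have "(\<integral>x. f x \<partial>D) = (\<integral>x. f x \<partial>distr (Pi\<^sub>M (UNIV::nat set) (\<lambda>_. D)) D (\<lambda>y. y i))"
    using assms by (subst distr_PiM_component[where M="\<lambda>_. D"]) auto
  also have "\<dots> = (\<integral>y. f (y i) \<partial>Pi\<^sub>M UNIV (\<lambda>_. D))"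
    using assms by (subst integral_distr) auto
  finally show ?thesis ..
qed

lemma indep_vars_iid_coordinates:
  assumes D: "prob_space D"
  shows "prob_space.indep_vars (Pi\<^sub>M (UNIV :: nat set) (\<lambda>_. D)) (\<lambda>_. D) (\<lambda>i y. y i) UNIV"
proof -
  interpret P: prob_space "Pi\<^sub>M (UNIV :: nat set) (\<lambda>_. D)"
    using D by (intro prob_space_PiM)
  show ?thesis
    using D distr_PiM_component[where I="UNIV :: nat set" and M="\<lambda>_. D"]
    by (subst P.indep_vars_iff_distr_eq_PiM) (auto simp: restrict_UNIV distr_id)
qed

lemma integral_iid_product_zero:
  fixes c :: "'a \<Rightarrow> real"
  assumes D: "prob_space D" and c: "c \<in> borel_measurable D" "\<And>x. x \<in> space D \<Longrightarrow> \<bar>c x\<bar> \<le> B"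
    and mean: "(\<integral>x. c x \<partial>D) = 0" and ij: "i \<noteq> (j::nat)"
  shows "(\<integral>y. c (y i) * c (y j) \<partial>Pi\<^sub>M UNIV (\<lambda>_. D)) = 0"
proof -
  interpret P: prob_space "Pi\<^sub>M (UNIV :: nat set) (\<lambda>_. D)"
    using D by (intro prob_space_PiM)
  have mc: "(\<lambda>y. c (y k)) \<in> borel_measurable (Pi\<^sub>M (UNIV :: nat set) (\<lambda>_. D))" for k
    using c(1) by measurable
  have int: "integrable (Pi\<^sub>M (UNIV :: nat set) (\<lambda>_. D)) (\<lambda>y. c (y k))" for k
    by (rule P.integrable_const_bound[where B=B]) (use mc c(2) in \<open>auto simp: space_PiM PiE_iff\<close>)
  have "P.indep_vars (\<lambda>_. borel) (\<lambda>i y. c (y i)) UNIV"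
    by (rule P.indep_vars_compose2[OF indep_vars_iid_coordinates[OF D]]) (use c in auto)
  then have "P.indep_vars (\<lambda>_. borel) (\<lambda>i y. c (y i)) {i, j}"
    by (rule P.indep_vars_subset) auto
  then have "(\<integral>y. (\<Prod>k\<in>{i,j}. c (y k)) \<partial>Pi\<^sub>M UNIV (\<lambda>_. D)) = (\<Prod>k\<in>{i,j}. \<integral>y. c (y k) \<partial>Pi\<^sub>M UNIV (\<lambda>_. D))"
    using int by (intro P.indep_vars_lebesgue_integral) auto
  then show ?thesis
    using ij integral_iid_coordinate[OF D c(1)] mean by simp
qed

text \<open>
  The off-diagonal terms of the squared sum vanish because distinct coordinates are independent and
  centred; this orthogonality is what makes the \<open>l\<^sup>2\<close> norm of the weights appear, and it is the
  only place where independence enters.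
\<close>

lemma second_moment_iid_sum:
  fixes c :: "'a \<Rightarrow> real" and p :: "nat \<Rightarrow> real"
  assumes D: "prob_space D" and c: "c \<in> borel_measurable D" "\<And>x. x \<in> space D \<Longrightarrow> \<bar>c x\<bar> \<le> B"
    and mean: "(\<integral>x. c x \<partial>D) = 0"
  shows "(\<integral>y. (\<Sum>i<m. p i * c (y i))\<^sup>2 \<partial>Pi\<^sub>M UNIV (\<lambda>_. D)) = (\<Sum>i<m. (p i)\<^sup>2) * (\<integral>x. (c x)\<^sup>2 \<partial>D)"
proof -
  interpret P: prob_space "Pi\<^sub>M (UNIV :: nat set) (\<lambda>_. D)"
    using D by (intro prob_space_PiM)
  have mc: "(\<lambda>y. c (y k)) \<in> borel_measurable (Pi\<^sub>M (UNIV :: nat set) (\<lambda>_. D))" for k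
    using c(1) by measurable
  have bd: "\<bar>c (y k)\<bar> \<le> B" if "y \<in> space (Pi\<^sub>M (UNIV :: nat set) (\<lambda>_. D))" for y k
    using that c(2) by (auto simp: space_PiM PiE_iff)
  have int: "integrable (Pi\<^sub>M (UNIV :: nat set) (\<lambda>_. D)) (\<lambda>y. c (y i) * c (y j))" for i j
  proof (rule P.integrable_const_bound[where B="B * B"])
    show "AE y in Pi\<^sub>M UNIV (\<lambda>_. D). norm (c (y i) * c (y j)) \<le> B * B"
      using bd by (intro AE_I2) (auto simp: abs_mult intro!: mult_mono order.trans[OF abs_ge_zero bd])
  qed (use mc in measurable)
  have "(\<integral>y. (\<Sum>i<m. p i * c (y i))\<^sup>2 \<partial>Pi\<^sub>M UNIV (\<lambda>_. D))
      = (\<integral>y. (\<Sum>i<m. \<Sum>j<m. p i * p j * (c (y i) * c (y j))) \<partial>Pi\<^sub>M UNIV (\<lambda>_. D))"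
    by (simp add: power2_eq_square sum_product mult_ac)
  also have "\<dots> = (\<Sum>i<m. \<Sum>j<m. p i * p j * (\<integral>y. c (y i) * c (y j) \<partial>Pi\<^sub>M UNIV (\<lambda>_. D)))"
    using int by (subst Bochner_Integration.integral_sum; (intro Bochner_Integration.integrable_sum)?; simp)+
  also have "\<dots> = (\<Sum>i<m. \<Sum>j<m. if i = j then (p i)\<^sup>2 * (\<integral>x. (c x)\<^sup>2 \<partial>D) else 0)"
    using integral_iid_product_zero[OF D c mean]
      integral_iid_coordinate[OF D borel_measurable_power[OF c(1)], of _ 2]
    by (intro sum.cong) (auto simp: power2_eq_square)
  also have "\<dots> = (\<Sum>i<m. (p i)\<^sup>2) * (\<integral>x. (c x)\<^sup>2 \<partial>D)"
    by (simp add: sum_distrib_right)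
  finally show ?thesis .
qed

lemma (in prob_space) bounded_integrable_mean:
  fixes g :: "'a \<Rightarrow> real"
  assumes "g \<in> borel_measurable M" "\<And>x. x \<in> space M \<Longrightarrow> \<bar>g x\<bar> \<le> B"
  shows "integrable M g" "\<bar>\<integral>x. g x \<partial>M\<bar> \<le> B"
proof -
  show i: "integrable M g"
    using assms by (intro integrable_const_bound[where B=B]) auto
  have "\<bar>\<integral>x. g x \<partial>M\<bar> \<le> (\<integral>x. \<bar>g x\<bar> \<partial>M)"
    by (rule integral_abs_bound)
  also have "\<dots> \<le> (\<integral>x. B \<partial>M)"
    using i assms by (intro integral_mono integrable_abs) auto
  finally show "\<bar>\<integral>x. g x \<partial>M\<bar> \<le> B" by (simp add: prob_space)
qed

definition centred_sum :: "'a measure \<Rightarrow> (nat \<Rightarrow> real) \<Rightarrow> ('a \<Rightarrow> real) \<Rightarrow> (nat \<Rightarrow> 'a) \<Rightarrow> real" where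
  "centred_sum D p g y = (\<Sum>i. p i * (g (y i) - (\<integral>x. g x \<partial>D)))"

lemma centred_sum_summable:
  assumes D: "prob_space D" and p: "p \<in> l1"
    and g: "g \<in> borel_measurable D" "\<And>x. x \<in> space D \<Longrightarrow> \<bar>g x\<bar> \<le> B"
    and y: "\<And>i. y i \<in> space D"
  shows "summable (\<lambda>i. \<bar>p i * (g (y i) - (\<integral>x. g x \<partial>D))\<bar>)"
proof (rule summable_comparison_test')
  show "summable (\<lambda>i. \<bar>p i\<bar> * (2 * B))"
    using p by (intro summable_mult2) (simp add: l1_def)
  show "norm \<bar>p i * (g (y i) - (\<integral>x. g x \<partial>D))\<bar> \<le> \<bar>p i\<bar> * (2 * B)" for i
    using g(2)[OF y, of i] prob_space.bounded_integrable_mean(2)[OF D g]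
    by (auto simp: abs_mult intro!: mult_left_mono)
qed

text \<open>
  For the partial sums the bound is Chebyshev's inequality, applied to a variable that differs from
  its mean by at most \<open>2 * B\<close>. Fatou's lemma carries the second moment over to the infinite sum.
\<close>

lemma centred_sum_Chebyshev:
  assumes D: "prob_space D" and p: "p \<in> l1"
    and g: "g \<in> borel_measurable D" "\<And>x. x \<in> space D \<Longrightarrow> \<bar>g x\<bar> \<le> B"
    and r: "r > 0"
  shows "emeasure (Pi\<^sub>M UNIV (\<lambda>_. D)) {y \<in> space (Pi\<^sub>M UNIV (\<lambda>_. D)). \<bar>centred_sum D p g y\<bar> \<ge> r}
    \<le> ennreal (4 * B\<^sup>2 * (\<Sum>i. (p i)\<^sup>2) / r\<^sup>2)"
proof -
  let ?P = "Pi\<^sub>M (UNIV :: nat set) (\<lambda>_. D)"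
  interpret D: prob_space D by fact
  interpret P: prob_space ?P
    using D by (intro prob_space_PiM)
  define c where "c x = g x - (\<integral>x. g x \<partial>D)" for x
  note ig = D.bounded_integrable_mean[OF g]
  have c: "c \<in> borel_measurable D" "\<And>x. x \<in> space D \<Longrightarrow> \<bar>c x\<bar> \<le> 2 * B"
    using g ig(2) unfolding c_def by (measurable, fastforce)
  have mean: "(\<integral>x. c x \<partial>D) = 0"
    using ig by (simp add: c_def D.prob_space)
  have c2: "(\<integral>x. (c x)\<^sup>2 \<partial>D) \<le> 4 * B\<^sup>2"
  proof -
    have "\<bar>(c x)\<^sup>2\<bar> \<le> (2 * B)\<^sup>2" if "x \<in> space D" for x
      using c(2)[OF that] abs_le_square_iff[of "c x" "2 * B"] by simp
    then have "\<bar>\<integral>x. (c x)\<^sup>2 \<partial>D\<bar> \<le> (2 * B)\<^sup>2"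
      using c(1) by (intro D.bounded_integrable_mean(2)) auto
    then show ?thesis by (simp add: power_mult_distrib)
  qed
  have mc[measurable]: "(\<lambda>y. c (y k)) \<in> borel_measurable ?P" for k
    using c(1) by measurable
  have bd: "\<bar>c (y k)\<bar> \<le> 2 * B" if "y \<in> space ?P" for y k
    using that c(2) by (auto simp: space_PiM PiE_iff)
  define S where "S m y = (\<Sum>i<m. p i * c (y i))" for m and y :: "nat \<Rightarrow> 'a"
  have mS[measurable]: "S m \<in> borel_measurable ?P" for m
    unfolding S_def by measurable
  have cs: "centred_sum D p g y = (\<Sum>i. p i * c (y i))" for y
    by (simp add: centred_sum_def c_def)
  have mcs[measurable]: "centred_sum D p g \<in> borel_measurable ?P"
    unfolding cs[abs_def] by measurable
  have nnS: "(\<integral>\<^sup>+y. ennreal ((S m y)\<^sup>2) \<partial>?P) \<le> ennreal (4 * B\<^sup>2 * (\<Sum>i. (p i)\<^sup>2))" for m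
  proof -
    have "\<bar>S m y\<bar> \<le> (\<Sum>i<m. \<bar>p i\<bar> * (2 * B))" if "y \<in> space ?P" for y
      unfolding S_def using bd[OF that]
      by (intro order.trans[OF sum_abs] sum_mono) (auto simp: abs_mult intro!: mult_left_mono)
    then have "\<bar>(S m y)\<^sup>2\<bar> \<le> (\<Sum>i<m. \<bar>p i\<bar> * (2 * B))\<^sup>2" if "y \<in> space ?P" for y
      using that abs_le_square_iff[of "S m y"] by (smt (verit) abs_ge_zero abs_power2)
    then have int: "integrable ?P (\<lambda>y. (S m y)\<^sup>2)"
      by (intro P.bounded_integrable_mean(1)) auto
    have "(\<integral>\<^sup>+y. ennreal ((S m y)\<^sup>2) \<partial>?P) = ennreal (\<integral>y. (S m y)\<^sup>2 \<partial>?P)"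
      using int by (intro nn_integral_eq_integral) auto
    also have "(\<integral>y. (S m y)\<^sup>2 \<partial>?P) = (\<Sum>i<m. (p i)\<^sup>2) * (\<integral>x. (c x)\<^sup>2 \<partial>D)"
      unfolding S_def by (rule second_moment_iid_sum[OF D c mean])
    also have "\<dots> \<le> (\<Sum>i. (p i)\<^sup>2) * (4 * B\<^sup>2)"
      using c2 l1_square_summable[OF p]
      by (intro mult_mono sum_le_suminf suminf_nonneg) (auto intro!: integral_nonneg)
    finally show ?thesis by (simp add: mult.commute ennreal_leI)
  qed
  have lim: "(\<lambda>m. S m y) \<longlonglongrightarrow> centred_sum D p g y" if "y \<in> space ?P" for y
  proof -
    have "summable (\<lambda>i. \<bar>p i * c (y i)\<bar>)"
      unfolding c_def using that by (intro centred_sum_summable[OF D p g]) (auto simp: space_PiM PiE_iff)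
    then have "summable (\<lambda>i. p i * c (y i))" by (rule summable_rabs_cancel)
    then show ?thesis unfolding S_def cs by (rule summable_LIMSEQ)
  qed
  have "(\<integral>\<^sup>+y. ennreal ((centred_sum D p g y)\<^sup>2) \<partial>?P) = (\<integral>\<^sup>+y. liminf (\<lambda>m. ennreal ((S m y)\<^sup>2)) \<partial>?P)"
    using lim by (intro nn_integral_cong lim_imp_Liminf[symmetric] tendsto_ennrealI tendsto_power) auto
  also have "\<dots> \<le> liminf (\<lambda>m. \<integral>\<^sup>+y. ennreal ((S m y)\<^sup>2) \<partial>?P)"
    by (rule nn_integral_liminf) measurable
  also have "\<dots> \<le> ennreal (4 * B\<^sup>2 * (\<Sum>i. (p i)\<^sup>2))"
    using nnS by (intro Liminf_le always_eventually) auto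
  finally have 2: "(\<integral>\<^sup>+y. ennreal ((centred_sum D p g y)\<^sup>2) \<partial>?P) \<le> ennreal (4 * B\<^sup>2 * (\<Sum>i. (p i)\<^sup>2))" .
  have "{y \<in> space ?P. \<bar>centred_sum D p g y\<bar> \<ge> r}
    = {y \<in> space ?P. 1 \<le> ennreal (1 / r\<^sup>2) * ennreal ((centred_sum D p g y)\<^sup>2)}"
    using r abs_le_square_iff[of r] by (auto simp: ennreal_mult'[symmetric] le_divide_eq)
  also have "emeasure ?P \<dots> \<le> ennreal (1 / r\<^sup>2) * (\<integral>\<^sup>+y. ennreal ((centred_sum D p g y)\<^sup>2) * indicator (space ?P) y \<partial>?P)"
    by (rule nn_integral_Markov_inequality) measurable
  also have "(\<integral>\<^sup>+y. ennreal ((centred_sum D p g y)\<^sup>2) * indicator (space ?P) y \<partial>?P) = (\<integral>\<^sup>+y. ennreal ((centred_sum D p g y)\<^sup>2) \<partial>?P)"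
    by (intro nn_integral_cong) auto
  also have "ennreal (1 / r\<^sup>2) * \<dots> \<le> ennreal (1 / r\<^sup>2) * ennreal (4 * B\<^sup>2 * (\<Sum>i. (p i)\<^sup>2))"
    using 2 by (rule mult_left_mono) simp
  finally show ?thesis by (simp add: ennreal_mult'[symmetric])
qed

text \<open>
  One half of the bracketing argument. Nonnegative weights preserve \<open>g \<le> u\<close> at the observations, so
  replacing \<open>g\<close> by \<open>u\<close> can lower the sum only through the centring, by at most the total weight
  times the difference of the two means.
\<close>

lemma centred_sum_le:
  assumes D: "prob_space D" and p: "p \<in> l1_pos"
    and g: "g \<in> borel_measurable D" "\<And>x. x \<in> space D \<Longrightarrow> \<bar>g x\<bar> \<le> B"
    and u: "u \<in> borel_measurable D" "\<And>x. x \<in> space D \<Longrightarrow> \<bar>u x\<bar> \<le> B"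
    and le: "\<And>x. x \<in> space D \<Longrightarrow> g x \<le> u x" and gap: "(\<integral>x. u x \<partial>D) - (\<integral>x. g x \<partial>D) \<le> \<epsilon>"
    and y: "\<And>i. y i \<in> space D"
  shows "centred_sum D p g y \<le> centred_sum D p u y + suminf p * \<epsilon>"
proof -
  note sg = summable_rabs_cancel[OF centred_sum_summable[OF D l1_posD(1)[OF p] g y]]
  note su = summable_rabs_cancel[OF centred_sum_summable[OF D l1_posD(1)[OF p] u y]]
  have "centred_sum D p g y \<le> (\<Sum>i. p i * (u (y i) - (\<integral>x. u x \<partial>D)) + p i * \<epsilon>)"
    unfolding centred_sum_def
  proof (rule suminf_le[OF _ sg])
    show "p i * (g (y i) - (\<integral>x. g x \<partial>D)) \<le> p i * (u (y i) - (\<integral>x. u x \<partial>D)) + p i * \<epsilon>" for i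
    proof -
      have "p i * (g (y i) - (\<integral>x. g x \<partial>D)) \<le> p i * ((u (y i) - (\<integral>x. u x \<partial>D)) + \<epsilon>)"
        using le[OF y, of i] gap l1_posD(2)[OF p] by (intro mult_left_mono) auto
      then show ?thesis by (simp add: distrib_left)
    qed
    show "summable (\<lambda>i. p i * (u (y i) - (\<integral>x. u x \<partial>D)) + p i * \<epsilon>)"
      using su l1_posD(3)[OF p] by (intro summable_add summable_mult2)
  qed
  also have "\<dots> = centred_sum D p u y + suminf p * \<epsilon>"
    unfolding centred_sum_def
    using su l1_posD(3)[OF p] by (simp add: suminf_add[symmetric] suminf_mult2 summable_mult2)
  finally show ?thesis .
qed

section \<open>Truncation at a level of the envelope\<close>

lemma envelope_upper: "f \<in> F \<Longrightarrow> ennreal \<bar>f y\<bar> \<le> envelope F y"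
  unfolding envelope_def by (rule SUP_upper)

lemma pointwise_measurableD:
  assumes "pointwise_measurable X F F0"
  shows "countable F0" "F0 \<subseteq> F" "f \<in> F \<Longrightarrow> f \<in> borel_measurable X"
    "f \<in> F \<Longrightarrow> \<exists>g. (\<forall>k. g k \<in> F0) \<and> (\<forall>x\<in>space X. (\<lambda>k. g k x) \<longlonglongrightarrow> f x)"
  using assms unfolding pointwise_measurable_def by auto

text \<open>
  The defining supremum may be uncountable, but pointwise approximation by the countable separant
  does not change it.
\<close>

lemma envelope_measurable:
  assumes F: "pointwise_measurable X F F0"
  shows "envelope F \<in> borel_measurable X"
proof -
  note FD = pointwise_measurableD[OF F]
  have "envelope F y = (SUP f\<in>F0. ennreal \<bar>f y\<bar>)" if y: "y \<in> space X" for y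
  proof (rule antisym)
    show "envelope F y \<le> (SUP f\<in>F0. ennreal \<bar>f y\<bar>)"
      unfolding envelope_def
    proof (rule SUP_least)
      fix f assume "f \<in> F"
      then obtain g where g: "\<And>k. g k \<in> F0" "(\<lambda>k. g k y) \<longlonglongrightarrow> f y"
        using FD(4) y by blast
      show "ennreal \<bar>f y\<bar> \<le> (SUP f\<in>F0. ennreal \<bar>f y\<bar>)"
      proof (rule LIMSEQ_le_const2)
        show "(\<lambda>k. ennreal \<bar>g k y\<bar>) \<longlonglongrightarrow> ennreal \<bar>f y\<bar>"
          using g(2) by (intro tendsto_ennrealI tendsto_rabs)
        show "\<exists>N. \<forall>k\<ge>N. ennreal \<bar>g k y\<bar> \<le> (SUP f\<in>F0. ennreal \<bar>f y\<bar>)"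
          using g(1) by (auto intro!: SUP_upper)
      qed
    qed
    show "(SUP f\<in>F0. ennreal \<bar>f y\<bar>) \<le> envelope F y"
      unfolding envelope_def using FD(2) by (intro SUP_subset_mono) auto
  qed
  moreover have "(\<lambda>y. SUP f\<in>F0. ennreal \<bar>f y\<bar>) \<in> borel_measurable X"
    using FD(1,2,3) by (intro borel_measurable_SUP) auto
  ultimately show ?thesis by (subst measurable_cong)
qed

lemma envelope_level_sets:
  assumes F: "pointwise_measurable X F F0"
  shows "indicator {y. envelope F y \<le> c} \<in> borel_measurable X"
    "indicator {y. c \<le> envelope F y} \<in> borel_measurable X"
  using envelope_measurable[OF F] by measurable

lemma truncated_measurable:
  assumes F: "pointwise_measurable X F F0" and f: "f \<in> F"
  shows "truncated F M f \<in> borel_measurable X"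
  using pointwise_measurableD(3)[OF F f] envelope_level_sets(1)[OF F]
  unfolding truncated_def[abs_def] by (intro borel_measurable_times)

lemma truncated_bounded:
  assumes "f \<in> F" "0 \<le> M"
  shows "\<bar>truncated F M f y\<bar> \<le> M"
  using envelope_upper[OF assms(1), of y] assms(2)
  by (auto simp: truncated_def indicator_def dest: order_trans)

text \<open>
  The endpoints of a bracket need neither be bounded nor lie below the envelope. Clipping them to
  \<open>[- M, M]\<close>, besides cutting at the level \<open>M\<close> of the envelope, makes Chebyshev's inequality
  applicable to them. Since clipping is monotone, contracts distances, and does to members of the
  class just what truncation does, the clipped bracket is no larger in mean and contains
  the truncated functions.
\<close>

definition clipped :: "('a \<Rightarrow> real) set \<Rightarrow> real \<Rightarrow> ('a \<Rightarrow> real) \<Rightarrow> 'a \<Rightarrow> real" where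
  "clipped F M g y = max (- M) (min M (g y)) * indicator {y. envelope F y \<le> ennreal M} y"

lemma clipped_measurable:
  assumes F: "pointwise_measurable X F F0" and g: "g \<in> borel_measurable X"
  shows "clipped F M g \<in> borel_measurable X"
  using g envelope_level_sets(1)[OF F]
  unfolding clipped_def[abs_def] by (intro borel_measurable_times borel_measurable_max borel_measurable_min) auto

lemma clipped_bounded: "0 \<le> M \<Longrightarrow> \<bar>clipped F M g y\<bar> \<le> M"
  by (auto simp: clipped_def indicator_def)

lemma clipped_mono: "g y \<le> h y \<Longrightarrow> clipped F M g y \<le> clipped F M h y"
  by (auto simp: clipped_def indicator_def)

lemma clipped_diff_le: "\<bar>clipped F M g y - clipped F M h y\<bar> \<le> \<bar>g y - h y\<bar>"
  by (auto simp: clipped_def indicator_def)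

lemma truncated_eq_clipped:
  assumes "f \<in> F" "0 \<le> M"
  shows "truncated F M f y = clipped F M f y"
  using truncated_bounded[OF assms, of y] by (auto simp: truncated_def clipped_def indicator_def)

lemma clipped_bracket_gap:
  assumes D: "prob_space D" and m: "clipped F M l \<in> borel_measurable D" "clipped F M u \<in> borel_measurable D"
    and M: "0 \<le> M" and gap: "L1_norm D (\<lambda>x. u x - l x) < ennreal \<epsilon>"
  shows "(\<integral>x. clipped F M u x \<partial>D) - (\<integral>x. clipped F M l x \<partial>D) \<le> \<epsilon>"
proof -
  interpret prob_space D by fact
  note i = bounded_integrable_mean(1)[OF m(1) clipped_bounded[OF M]]
    bounded_integrable_mean(1)[OF m(2) clipped_bounded[OF M]]
  have "ennreal \<bar>\<integral>x. clipped F M u x - clipped F M l x \<partial>D\<bar>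
    \<le> (\<integral>\<^sup>+x. ennreal \<bar>clipped F M u x - clipped F M l x\<bar> \<partial>D)"
    using integral_norm_bound_ennreal[OF Bochner_Integration.integrable_diff[OF i(2,1)]] by simp
  also have "\<dots> \<le> L1_norm D (\<lambda>x. u x - l x)"
    unfolding L1_norm_def by (intro nn_integral_mono ennreal_leI clipped_diff_le)
  finally have "ennreal \<bar>\<integral>x. clipped F M u x - clipped F M l x \<partial>D\<bar> < ennreal \<epsilon>"
    using gap by simp
  then show ?thesis using i by (simp add: ennreal_less_iff)
qed

text \<open>
  Below infinity the infimum runs over a nonempty set of natural numbers, hence it is a minimum.
\<close>

lemma bracketing_number_attained:
  assumes N: "ennreal_of_enat (bracketing_number X \<epsilon> F nrm) \<le> ennreal K" and K: "0 \<le> K"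
  obtains S where "finite S" "real (card S) \<le> K"
    "\<And>l u. (l, u) \<in> S \<Longrightarrow> l \<in> borel_measurable X" "\<And>l u. (l, u) \<in> S \<Longrightarrow> u \<in> borel_measurable X"
    "\<And>l u. (l, u) \<in> S \<Longrightarrow> nrm (\<lambda>x. u x - l x) < ennreal \<epsilon>"
    "F \<subseteq> (\<Union>(l, u)\<in>S. bracket X l u)"
proof -
  define A where "A = {enat (card S) | S. finite S \<and>
            (\<forall>(l, u)\<in>S. l \<in> borel_measurable X \<and> u \<in> borel_measurable X \<and>
               nrm (\<lambda>x. u x - l x) < ennreal \<epsilon>) \<and>
            F \<subseteq> (\<Union>(l, u)\<in>S. bracket X l u)}"
  have eq: "bracketing_number X \<epsilon> F nrm = Inf A" by (simp add: bracketing_number_def A_def)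
  have "A \<noteq> {}"
    using N unfolding eq by (auto simp: Inf_enat_def top_unique)
  then have "Inf A \<in> A" by (auto simp: Inf_enat_def intro: LeastI)
  then obtain S where S: "Inf A = enat (card S)" "finite S"
            "\<forall>(l, u)\<in>S. l \<in> borel_measurable X \<and> u \<in> borel_measurable X \<and>
               nrm (\<lambda>x. u x - l x) < ennreal \<epsilon>" "F \<subseteq> (\<Union>(l, u)\<in>S. bracket X l u)"
    unfolding A_def by blast
  have "real (card S) \<le> K"
    using N K unfolding eq S(1) by (simp add: ennreal_of_nat_eq_real_of_nat)
  with S show ?thesis by (intro that[of S]) auto
qed

section \<open>Uniform control of the truncated process for a fixed weight sequence\<close>

text \<open>
  With bounded summands, pointwise convergence of the functions passes to the means by dominated
  convergence and to the weighted series by Tannery's theorem. Hence the countable separant already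
  detects large values of the process, which makes the exceptional event measurable.
\<close>

lemma separant_exceeds:
  assumes D: "prob_space D" "sets D = sets X" and p: "p \<in> l1"
    and F: "pointwise_measurable X F F0" and M: "0 \<le> M" and f: "f \<in> F"
    and y: "\<And>i. y i \<in> space D"
    and big: "r < \<bar>centred_sum D p (truncated F M f) y\<bar>"
  shows "\<exists>f\<in>F0. r < \<bar>centred_sum D p (truncated F M f) y\<bar>"
proof -
  interpret prob_space D by fact
  note sp = sets_eq_imp_space_eq[OF D(2)]
  note FD = pointwise_measurableD[OF F]
  obtain g where g: "\<And>k. g k \<in> F0" "\<And>x. x \<in> space X \<Longrightarrow> (\<lambda>k. g k x) \<longlonglongrightarrow> f x"
    using FD(4)[OF f] by blast
  have gF: "g k \<in> F" for k using g(1) FD(2) by auto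
  have mt: "truncated F M h \<in> borel_measurable D" if "h \<in> F" for h
    using truncated_measurable[OF F that] measurable_cong_sets[OF D(2) refl] by auto
  have lim: "(\<lambda>k. truncated F M (g k) x) \<longlonglongrightarrow> truncated F M f x" if "x \<in> space D" for x
    unfolding truncated_def using g(2) that sp by (intro tendsto_mult_right) auto
  have lim_int: "(\<lambda>k. \<integral>x. truncated F M (g k) x \<partial>D) \<longlonglongrightarrow> (\<integral>x. truncated F M f x \<partial>D)"
    using mt[OF f] mt[OF gF] lim truncated_bounded[OF gF M]
    by (intro integral_dominated_convergence[where w="\<lambda>_. M"]) auto
  have "(\<lambda>k. centred_sum D p (truncated F M (g k)) y) \<longlonglongrightarrow> centred_sum D p (truncated F M f) y"
    unfolding centred_sum_def
  proof (rule tannerys_theorem[THEN conjunct2, THEN conjunct2])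
    show "((\<lambda>k. p i * (truncated F M (g k) (y i) - (\<integral>x. truncated F M (g k) x \<partial>D)))
        \<longlongrightarrow> p i * (truncated F M f (y i) - (\<integral>x. truncated F M f x \<partial>D))) sequentially" for i
      using lim[OF y] lim_int by (intro tendsto_mult_left tendsto_diff)
    have "norm (p i * (truncated F M (g k) (y i) - (\<integral>x. truncated F M (g k) x \<partial>D))) \<le> \<bar>p i\<bar> * (2 * M)" for i k
      using truncated_bounded[OF gF[of k] M, of "y i"]
        bounded_integrable_mean(2)[OF mt[OF gF[of k]] truncated_bounded[OF gF M]]
      by (auto simp: abs_mult intro!: mult_left_mono)
    then show "\<forall>\<^sub>F (i, k) in sequentially \<times>\<^sub>F sequentially.
        norm (p i * (truncated F M (g k) (y i) - (\<integral>x. truncated F M (g k) x \<partial>D))) \<le> \<bar>p i\<bar> * (2 * M)"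
      by (intro always_eventually) auto
    show "summable (\<lambda>i. \<bar>p i\<bar> * (2 * M))"
      using p by (intro summable_mult2) (simp add: l1_def)
  qed simp
  then have "eventually (\<lambda>k. r < \<bar>centred_sum D p (truncated F M (g k)) y\<bar>) sequentially"
    using big by (intro order_tendstoD(1)[OF tendsto_rabs])
  then obtain k where "r < \<bar>centred_sum D p (truncated F M (g k)) y\<bar>"
    using eventually_happens'[OF sequentially_bot] by blast
  then show ?thesis using g(1) by blast
qed

text \<open>
  The process at a function of the class lies, up to \<open>suminf p * \<epsilon> \<le> r\<close>, between its values at the
  two clipped endpoints of a bracket around that function. If its absolute value exceeds \<open>2 * r\<close>,
  then it is at least \<open>r\<close> at one of the at most \<open>2 * card S\<close> endpoints, and the union bound reduces to Chebyshev's inequality.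
\<close>

lemma maximal_inequality:
  assumes D: "prob_space D" "sets D = sets X" and p: "p \<in> l1_pos"
    and F: "pointwise_measurable X F F0" and M: "0 \<le> M"
    and S: "finite S" "\<And>l u. (l, u) \<in> S \<Longrightarrow> l \<in> borel_measurable X"
      "\<And>l u. (l, u) \<in> S \<Longrightarrow> u \<in> borel_measurable X"
      "\<And>l u. (l, u) \<in> S \<Longrightarrow> L1_norm D (\<lambda>x. u x - l x) < ennreal \<epsilon>"
    and cover: "F \<subseteq> (\<Union>(l, u)\<in>S. bracket X l u)"
    and r: "suminf p * \<epsilon> \<le> r" "0 < r"
  shows "emeasure (Pi\<^sub>M UNIV (\<lambda>_. D))
      {y \<in> space (Pi\<^sub>M UNIV (\<lambda>_. D)). \<exists>f\<in>F0. 2 * r < \<bar>centred_sum D p (truncated F M f) y\<bar>}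
    \<le> ennreal (8 * real (card S) * M\<^sup>2 * (\<Sum>i. (p i)\<^sup>2) / r\<^sup>2)" (is "emeasure ?P ?E \<le> _")
proof -
  define A where "A g = {y \<in> space ?P. r \<le> \<bar>centred_sum D p (clipped F M g) y\<bar>}" for g
  note sp = sets_eq_imp_space_eq[OF D(2)]
  have mc: "clipped F M g \<in> borel_measurable D" if "g \<in> borel_measurable X" for g
    using clipped_measurable[OF F that] measurable_cong_sets[OF D(2) refl] by auto
  have mA: "A g \<in> sets ?P" if "g \<in> borel_measurable X" for g
  proof -
    note mc[OF that, measurable]
    show ?thesis unfolding A_def centred_sum_def by measurable
  qed
  have eA: "emeasure ?P (A g) \<le> ennreal (4 * M\<^sup>2 * (\<Sum>i. (p i)\<^sup>2) / r\<^sup>2)"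
    if "g \<in> borel_measurable X" for g
    unfolding A_def
    by (rule centred_sum_Chebyshev[OF D(1) l1_posD(1)[OF p] mc[OF that] clipped_bounded[OF M] r(2)])
  have "?E \<subseteq> (\<Union>(l, u)\<in>S. A l \<union> A u)"
  proof (rule subsetI, elim CollectE conjE bexE)
    fix y f assume y: "y \<in> space ?P" and f0: "f \<in> F0"
      and big: "2 * r < \<bar>centred_sum D p (truncated F M f) y\<bar>"
    have f: "f \<in> F" using f0 pointwise_measurableD(2)[OF F] by auto
    from y have y': "y i \<in> space D" for i by (auto simp: space_PiM PiE_iff)
    obtain l u where lu: "(l, u) \<in> S" "f \<in> bracket X l u" using cover f by auto
    have le: "clipped F M l x \<le> clipped F M f x" "clipped F M f x \<le> clipped F M u x" if "x \<in> space D" for x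
      using lu(2) that sp by (auto simp: bracket_def intro!: clipped_mono)
    note ml = mc[OF S(2)[OF lu(1)]] and mu = mc[OF S(3)[OF lu(1)]]
    note mf = mc[OF pointwise_measurableD(3)[OF F f]]
    note cb = clipped_bounded[OF M]
    have int: "integrable D (clipped F M g)" if "clipped F M g \<in> borel_measurable D" for g
      by (rule prob_space.bounded_integrable_mean(1)[OF D(1) that cb])
    note gap = clipped_bracket_gap[OF D(1) ml mu M S(4)[OF lu(1)]]
    have m1: "(\<integral>x. clipped F M l x \<partial>D) \<le> (\<integral>x. clipped F M f x \<partial>D)"
      using int[OF ml] int[OF mf] le by (intro integral_mono) auto
    have m2: "(\<integral>x. clipped F M f x \<partial>D) \<le> (\<integral>x. clipped F M u x \<partial>D)"
      using int[OF mu] int[OF mf] le by (intro integral_mono) auto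
    have "centred_sum D p (clipped F M f) y \<le> centred_sum D p (clipped F M u) y + suminf p * \<epsilon>"
      using m1 m2 gap by (intro centred_sum_le[OF D(1) p mf cb mu cb le(2) _ y']) auto
    moreover have "centred_sum D p (clipped F M l) y \<le> centred_sum D p (clipped F M f) y + suminf p * \<epsilon>"
      using m1 m2 gap by (intro centred_sum_le[OF D(1) p ml cb mf cb le(1) _ y']) auto
    moreover have "truncated F M f = clipped F M f"
      using truncated_eq_clipped[OF f M] by auto
    ultimately have "r \<le> \<bar>centred_sum D p (clipped F M l) y\<bar> \<or> r \<le> \<bar>centred_sum D p (clipped F M u) y\<bar>"
      using big r by auto
    then show "y \<in> (\<Union>(l, u)\<in>S. A l \<union> A u)"
      using y lu(1) unfolding A_def by auto
  qed
  then have "emeasure ?P ?E \<le> emeasure ?P (\<Union>(l, u)\<in>S. A l \<union> A u)"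
    using S(1,2,3) mA by (intro emeasure_mono sets.finite_UN) auto
  also have "\<dots> \<le> (\<Sum>(l, u)\<in>S. emeasure ?P (A l \<union> A u))"
    using S(1,2,3) mA
    by (intro order.trans[OF emeasure_subadditive_finite]) (auto simp: case_prod_beta' intro!: sum_mono)
  also have "\<dots> \<le> (\<Sum>(l, u)\<in>S. ennreal (8 * M\<^sup>2 * (\<Sum>i. (p i)\<^sup>2) / r\<^sup>2))"
  proof (intro sum_mono, clarsimp)
    fix l u assume lu: "(l, u) \<in> S"
    have "emeasure ?P (A l \<union> A u) \<le> emeasure ?P (A l) + emeasure ?P (A u)"
      using mA S(2,3)[OF lu] by (intro emeasure_subadditive)
    also have "\<dots> \<le> ennreal (4 * M\<^sup>2 * (\<Sum>i. (p i)\<^sup>2) / r\<^sup>2) + ennreal (4 * M\<^sup>2 * (\<Sum>i. (p i)\<^sup>2) / r\<^sup>2)"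
      using eA S(2,3)[OF lu] by (intro add_mono)
    also have "\<dots> = ennreal (8 * M\<^sup>2 * (\<Sum>i. (p i)\<^sup>2) / r\<^sup>2)"
      using suminf_nonneg[OF l1_square_summable[OF l1_posD(1)[OF p]]]
      by (subst ennreal_plus[symmetric]) (auto simp: field_simps)
    finally show "emeasure ?P (A l \<union> A u) \<le> ennreal (8 * M\<^sup>2 * (\<Sum>i. (p i)\<^sup>2) / r\<^sup>2)" .
  qed
  also have "\<dots> = ennreal (8 * real (card S) * M\<^sup>2 * (\<Sum>i. (p i)\<^sup>2) / r\<^sup>2)"
    using suminf_nonneg[OF l1_square_summable[OF l1_posD(1)[OF p]]]
    by (simp add: ennreal_of_nat_eq_real_of_nat ennreal_mult'[symmetric] mult_ac)
  finally show ?thesis .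
qed

section \<open>The contribution of large envelope values\<close>

lemma ennreal_le_iff_one_le_scaled:
  assumes c: "0 < c"
  shows "ennreal c \<le> z \<longleftrightarrow> 1 \<le> ennreal (1 / c) * z"
proof (cases z)
  case (real t)
  then show ?thesis using c
    by (auto simp: ennreal_mult'[symmetric] ennreal_le_iff2 le_divide_eq simp flip: ennreal_1)
qed (use c in \<open>simp add: ennreal_mult_top\<close>)

text \<open>
  A majorant for the effect of the truncation: \<open>h\<close> will be the part of the envelope at or above
  the truncation level, and both the values and the means of the discarded pieces are counted. It takes
  extended values so that neither convergence nor integrability has to be known.
\<close>

definition weighted_excess :: "'a measure \<Rightarrow> (nat \<Rightarrow> real) \<Rightarrow> ('a \<Rightarrow> ennreal) \<Rightarrow> (nat \<Rightarrow> 'a) \<Rightarrow> ennreal" where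
  "weighted_excess D p h y = (\<Sum>i. ennreal (p i) * (h (y i) + (\<integral>\<^sup>+x. h x \<partial>D)))"

lemma weighted_excess_Markov:
  assumes D: "prob_space D" and p: "p \<in> l1_pos" and L: "suminf p \<le> L"
    and h[measurable]: "h \<in> borel_measurable D" and r: "0 < r"
  shows "emeasure (Pi\<^sub>M UNIV (\<lambda>_. D)) {y \<in> space (Pi\<^sub>M UNIV (\<lambda>_. D)). ennreal r \<le> weighted_excess D p h y}
    \<le> ennreal (2 * L / r) * (\<integral>\<^sup>+x. h x \<partial>D)" (is "emeasure ?P ?E \<le> _")
proof -
  interpret P: prob_space ?P
    using D by (intro prob_space_PiM)
  have "(\<integral>\<^sup>+y. weighted_excess D p h y \<partial>?P)
    = (\<Sum>i. ennreal (p i) * ((\<integral>\<^sup>+y. h (y i) \<partial>?P) + (\<integral>\<^sup>+x. h x \<partial>D)))"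
    unfolding weighted_excess_def
    by (subst nn_integral_suminf) (auto simp: nn_integral_cmult nn_integral_add P.emeasure_space_1)
  also have "\<dots> = (\<Sum>i. ennreal (p i)) * (2 * (\<integral>\<^sup>+x. h x \<partial>D))"
    by (simp add: nn_integral_iid_coordinate[OF D h] mult_2)
  also have "(\<Sum>i. ennreal (p i)) = ennreal (suminf p)"
    using l1_posD[OF p] by (intro suminf_ennreal2) auto
  also have "ennreal (suminf p) * (2 * (\<integral>\<^sup>+x. h x \<partial>D)) \<le> ennreal L * (2 * (\<integral>\<^sup>+x. h x \<partial>D))"
    using L by (intro mult_right_mono ennreal_leI) auto
  finally have int: "(\<integral>\<^sup>+y. weighted_excess D p h y \<partial>?P) \<le> ennreal L * (2 * (\<integral>\<^sup>+x. h x \<partial>D))" .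
  have "emeasure ?P ?E \<le> ennreal (1 / r) * (\<integral>\<^sup>+y. weighted_excess D p h y * indicator (space ?P) y \<partial>?P)"
    unfolding ennreal_le_iff_one_le_scaled[OF r]
    by (rule nn_integral_Markov_inequality) (auto simp: weighted_excess_def)
  also have "(\<integral>\<^sup>+y. weighted_excess D p h y * indicator (space ?P) y \<partial>?P) = (\<integral>\<^sup>+y. weighted_excess D p h y \<partial>?P)"
    by (intro nn_integral_cong) auto
  also have "ennreal (1 / r) * \<dots> \<le> ennreal (1 / r) * (ennreal L * (2 * (\<integral>\<^sup>+x. h x \<partial>D)))"
    using int by (rule mult_left_mono) simp
  also have "\<dots> = ennreal (2 * L / r) * (\<integral>\<^sup>+x. h x \<partial>D)"
  proof -
    have "0 \<le> L" using L suminf_nonneg[OF l1_posD(3)[OF p] l1_posD(2)[OF p]] by simp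
    then have "ennreal (2 * L / r) = ennreal (1 / r) * (ennreal L * 2)"
      using r by (subst ennreal_numeral[symmetric]) (simp add: ennreal_mult'[symmetric] mult.commute del: ennreal_numeral)
    then show ?thesis by (simp add: mult_ac)
  qed
  finally show ?thesis .
qed

text \<open>
  Two truncations of the same function differ only where the envelope is at least the lower level,
  and there by at most the envelope. The bound is independent of both the function and the upper
  level, so it survives the supremum over the class and the passage \<open>M' \<rightarrow> \<infinity>\<close>.
\<close>

lemma truncation_change_le_excess:
  assumes D: "prob_space D" "sets D = sets X" and p: "p \<in> l1_pos"
    and F: "pointwise_measurable X F F0" and M: "0 \<le> M" "M \<le> M'" and f: "f \<in> F"
    and y: "\<And>i. y i \<in> space D"
  shows "ennreal \<bar>centred_sum D p (truncated F M' f) y - centred_sum D p (truncated F M f) y\<bar>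
    \<le> weighted_excess D p (\<lambda>x. envelope F x * indicator {x. ennreal M \<le> envelope F x} x) y"
proof -
  interpret prob_space D by fact
  let ?h = "\<lambda>x. envelope F x * indicator {x. ennreal M \<le> envelope F x} x"
  have M': "0 \<le> M'" using M by simp
  have mt: "truncated F N f \<in> borel_measurable D" for N
    using truncated_measurable[OF F f] measurable_cong_sets[OF D(2) refl] by auto
  note i' = bounded_integrable_mean(1)[OF mt truncated_bounded[OF f M']]
    and i = bounded_integrable_mean(1)[OF mt truncated_bounded[OF f M(1)]]
  have diff: "ennreal \<bar>truncated F M' f x - truncated F M f x\<bar> \<le> ?h x" for x
  proof (cases "envelope F x \<le> ennreal M")
    case True
    then have "envelope F x \<le> ennreal M'" using M by (meson ennreal_leI order_trans)
    with True show ?thesis by (simp add: truncated_def)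
  next
    case False
    then show ?thesis using envelope_upper[OF f, of x] by (auto simp: truncated_def indicator_def)
  qed
  define a where "a i = p i * (truncated F M' f (y i) - (\<integral>x. truncated F M' f x \<partial>D))
      - p i * (truncated F M f (y i) - (\<integral>x. truncated F M f x \<partial>D))" for i
  have s': "summable (\<lambda>i. \<bar>p i * (truncated F M' f (y i) - (\<integral>x. truncated F M' f x \<partial>D))\<bar>)"
    by (rule centred_sum_summable[OF D(1) l1_posD(1)[OF p] mt truncated_bounded[OF f M'] y])
  have s: "summable (\<lambda>i. \<bar>p i * (truncated F M f (y i) - (\<integral>x. truncated F M f x \<partial>D))\<bar>)"
    by (rule centred_sum_summable[OF D(1) l1_posD(1)[OF p] mt truncated_bounded[OF f M(1)] y])
  have sa: "summable (\<lambda>i. \<bar>a i\<bar>)"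
    by (rule summable_comparison_test'[OF summable_add[OF s' s], of 0]) (auto simp: a_def)
  have "centred_sum D p (truncated F M' f) y - centred_sum D p (truncated F M f) y = suminf a"
    unfolding centred_sum_def a_def
    by (rule suminf_diff[OF summable_rabs_cancel[OF s'] summable_rabs_cancel[OF s]])
  then have "ennreal \<bar>centred_sum D p (truncated F M' f) y - centred_sum D p (truncated F M f) y\<bar>
    \<le> ennreal (\<Sum>i. \<bar>a i\<bar>)"
    using summable_rabs[OF sa] by (simp add: ennreal_leI)
  also have "\<dots> = (\<Sum>i. ennreal \<bar>a i\<bar>)"
    using sa by (intro suminf_ennreal2[symmetric]) auto
  also have "\<dots> \<le> weighted_excess D p ?h y"
    unfolding weighted_excess_def
  proof (intro suminf_le summableI)
    fix k
    have "a k = p k * ((truncated F M' f (y k) - truncated F M f (y k))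
        - (\<integral>x. truncated F M' f x - truncated F M f x \<partial>D))"
      unfolding a_def Bochner_Integration.integral_diff[OF i' i] by (simp add: algebra_simps)
    then have "\<bar>a k\<bar> \<le> p k * (\<bar>truncated F M' f (y k) - truncated F M f (y k)\<bar>
        + \<bar>\<integral>x. truncated F M' f x - truncated F M f x \<partial>D\<bar>)"
      using l1_posD(2)[OF p, of k] by (auto simp: abs_mult intro!: mult_left_mono)
    then have "ennreal \<bar>a k\<bar> \<le> ennreal (p k) * (ennreal \<bar>truncated F M' f (y k) - truncated F M f (y k)\<bar>
        + ennreal \<bar>\<integral>x. truncated F M' f x - truncated F M f x \<partial>D\<bar>)"
      using l1_posD(2)[OF p, of k] by (simp add: ennreal_mult'[symmetric] ennreal_plus[symmetric] ennreal_leI del: ennreal_plus)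
    also have "\<dots> \<le> ennreal (p k) * (?h (y k) + (\<integral>\<^sup>+x. ?h x \<partial>D))"
    proof (intro mult_left_mono add_mono diff)
      have "ennreal \<bar>\<integral>x. truncated F M' f x - truncated F M f x \<partial>D\<bar>
          \<le> (\<integral>\<^sup>+x. ennreal \<bar>truncated F M' f x - truncated F M f x\<bar> \<partial>D)"
        using integral_norm_bound_ennreal[OF Bochner_Integration.integrable_diff[OF i' i]] by simp
      also have "\<dots> \<le> (\<integral>\<^sup>+x. ?h x \<partial>D)" by (intro nn_integral_mono diff)
      finally show "ennreal \<bar>\<integral>x. truncated F M' f x - truncated F M f x \<partial>D\<bar> \<le> (\<integral>\<^sup>+x. ?h x \<partial>D)" .
    qed simp
    finally show "ennreal \<bar>a k\<bar> \<le> ennreal (p k) * (?h (y k) + (\<integral>\<^sup>+x. ?h x \<partial>D))" .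
  qed
  finally show ?thesis .
qed

section \<open>Outer measure and convergence in probability\<close>

lemma outer_measure_of_Un_le:
  assumes "A \<subseteq> space M" "B \<subseteq> space M"
  shows "outer_measure_of M (A \<union> B) \<le> outer_measure_of M A + outer_measure_of M B"
proof -
  obtain A' B' where A: "A' \<in> sets M" "A \<subseteq> A'" "outer_measure_of M A = emeasure M A'"
    and B: "B' \<in> sets M" "B \<subseteq> B'" "outer_measure_of M B = emeasure M B'"
    using outer_measure_of_attain assms by metis
  have "outer_measure_of M (A \<union> B) \<le> outer_measure_of M (A' \<union> B')"
    using A B by (intro outer_measure_of_mono) auto
  also have "\<dots> \<le> emeasure M A' + emeasure M B'"
    using A B by (simp add: emeasure_subadditive)
  finally show ?thesis using A B by simp
qed

lemma outer_measure_of_AE_zero: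
  assumes "AE x in M. P x"
  shows "outer_measure_of M {x \<in> space M. \<not> P x} = 0"
proof -
  obtain N where N: "{x \<in> space M. \<not> P x} \<subseteq> N" "emeasure M N = 0" "N \<in> sets M"
    using assms by (auto elim: AE_E)
  have "outer_measure_of M {x \<in> space M. \<not> P x} \<le> outer_measure_of M N"
    using N(1) by (rule outer_measure_of_mono)
  then show ?thesis using N by simp
qed

lemma outer_expectation_Markov:
  assumes c: "0 < c" and less: "outer_expectation P Z < ennreal (c * \<eta>)"
  shows "outer_measure_of P {\<omega> \<in> space P. ennreal c \<le> Z \<omega>} \<le> ennreal \<eta>"
proof -
  obtain U where U[measurable]: "U \<in> borel_measurable P" and le: "\<And>\<omega>. \<omega> \<in> space P \<Longrightarrow> Z \<omega> \<le> U \<omega>"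
    and int: "(\<integral>\<^sup>+\<omega>. U \<omega> \<partial>P) < ennreal (c * \<eta>)"
    using less unfolding outer_expectation_def by (auto simp: INF_less_iff)
  have "outer_measure_of P {\<omega> \<in> space P. ennreal c \<le> Z \<omega>} \<le> outer_measure_of P {\<omega> \<in> space P. ennreal c \<le> U \<omega>}"
    using le by (intro outer_measure_of_mono) (auto intro: order_trans)
  also have "\<dots> = emeasure P {\<omega> \<in> space P. ennreal c \<le> U \<omega>}"
    by (intro outer_measure_of_eq) measurable
  also have "\<dots> \<le> ennreal (1 / c) * (\<integral>\<^sup>+\<omega>. U \<omega> * indicator (space P) \<omega> \<partial>P)"
    unfolding ennreal_le_iff_one_le_scaled[OF c] by (rule nn_integral_Markov_inequality) measurable
  also have "(\<integral>\<^sup>+\<omega>. U \<omega> * indicator (space P) \<omega> \<partial>P) = (\<integral>\<^sup>+\<omega>. U \<omega> \<partial>P)"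
    by (intro nn_integral_cong) auto
  also have "ennreal (1 / c) * \<dots> \<le> ennreal (1 / c) * ennreal (c * \<eta>)"
    using int by (intro mult_left_mono) auto
  also have "\<dots> = ennreal \<eta>" using c by (simp add: ennreal_mult'[symmetric])
  finally show ?thesis .
qed

lemma ennreal_tendsto_0I:
  fixes u :: "'b \<Rightarrow> ennreal"
  assumes "\<And>e::real. 0 < e \<Longrightarrow> eventually (\<lambda>n. u n \<le> ennreal e) F"
  shows "(u \<longlongrightarrow> 0) F"
proof (rule order_tendstoI)
  fix a :: ennreal assume "0 < a"
  then obtain b where b: "0 < b" "b < a" using dense by blast
  then obtain e where "b = ennreal e" "0 < e" by (cases b) auto
  with b show "eventually (\<lambda>n. u n < a) F" using assms[of e] by (auto elim!: eventually_mono)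
qed simp

lemma bounded_in_probD:
  assumes "bounded_in_prob P Z" "0 < \<eta>"
  obtains K :: real where "0 < K"
    "eventually (\<lambda>n. outer_measure_of P {\<omega> \<in> space P. ennreal K < Z n \<omega>} \<le> ennreal \<eta>) sequentially"
proof -
  have "eventually (\<lambda>K. limsup (\<lambda>n. outer_measure_of P {\<omega> \<in> space P. ennreal K < Z n \<omega>}) < ennreal \<eta>) at_top"
    using assms by (intro order_tendstoD(2)) (auto simp: bounded_in_prob_def)
  then have "eventually (\<lambda>K. 0 < K \<and> limsup (\<lambda>n. outer_measure_of P {\<omega> \<in> space P. ennreal K < Z n \<omega>}) < ennreal \<eta>) at_top"
    using eventually_gt_at_top[of 0] by eventually_elim simp
  then obtain K where K: "0 < K" "limsup (\<lambda>n. outer_measure_of P {\<omega> \<in> space P. ennreal K < Z n \<omega>}) < ennreal \<eta>"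
    using eventually_happens'[OF trivial_limit_at_top_linorder] by blast
  then show ?thesis
    using Limsup_lessD[OF K(2)] by (intro that[of K]) (auto elim: eventually_mono)
qed

section \<open>Disintegration of the array over the weights\<close>

text \<open>
  Coordinates are 1-Lipschitz for the \<open>l\<^sup>1\<close> distance, hence continuous.
\<close>

lemma l1_coordinate_measurable: "(\<lambda>p. p i) \<in> borel_measurable l1_borel"
proof (rule borel_measurableI)
  fix U :: "real set" assume U: "open U"
  interpret Metric_space l1 l1_dist by (rule Metric_space_l1)
  have "openin mtopology ((\<lambda>p. p i) -` U \<inter> l1)"
    unfolding openin_mtopology
  proof (intro conjI allI impI)
    fix p assume "p \<in> (\<lambda>p. p i) -` U \<inter> l1"
    then obtain e where e: "e > 0" "ball (p i) e \<subseteq> U" and p: "p \<in> l1"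
      using U openE by (metis IntE vimageE)
    have "\<bar>p i - q i\<bar> \<le> l1_dist p q" if "q \<in> l1" for q
    proof -
      have s: "summable (\<lambda>j. \<bar>p j - q j\<bar>)"
        by (rule summable_comparison_test'[where g="\<lambda>j. \<bar>p j\<bar> + \<bar>q j\<bar>" and N=0])
          (use p that in \<open>auto simp: l1_def intro: summable_add\<close>)
      have "\<bar>p i - q i\<bar> \<le> (\<Sum>j. \<bar>p j - q j\<bar>)"
        using sum_le_suminf[OF s, of "{i}"] by simp
      then show ?thesis using suminf_nonneg[OF s] by (simp add: l1_dist_def seq_norm_def)
    qed
    then have "mball p e \<subseteq> (\<lambda>p. p i) -` U \<inter> l1"
      using e by (force simp: in_mball dist_real_def)
    then show "\<exists>r>0. mball p r \<subseteq> (\<lambda>p. p i) -` U \<inter> l1" using e by blast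
  qed auto
  then show "(\<lambda>p. p i) -` U \<inter> space l1_borel \<in> sets l1_borel"
    by (auto simp: sets_l1_borel intro: sigma_sets.Basic)
qed

text \<open>
  The part of the setting that fixes the law of the array, without the class of functions.
\<close>

locale triangular_array =
  fixes X :: "'a measure"
    and \<kappa> :: "nat \<Rightarrow> (nat \<Rightarrow> real) \<Rightarrow> 'a measure"
    and Q :: "nat \<Rightarrow> (nat \<Rightarrow> real) measure"
  assumes kernel: "\<And>n. n \<ge> 1 \<Longrightarrow> \<kappa> n \<in> l1_borel \<rightarrow>\<^sub>M prob_algebra X"
    and Q_prob: "\<And>n. n \<ge> 1 \<Longrightarrow> prob_space (Q n)"
    and Q_borel: "\<And>n. n \<ge> 1 \<Longrightarrow> sets (Q n) = sets l1_borel"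
begin

abbreviation "\<P> \<equiv> array_space X \<kappa> Q"
abbreviation "row_algebra \<equiv> l1_borel \<Otimes>\<^sub>M Pi\<^sub>M (UNIV :: nat set) (\<lambda>_. X)"

lemma kernel_prob: "n \<ge> 1 \<Longrightarrow> p \<in> l1 \<Longrightarrow> prob_space (\<kappa> n p)"
  and kernel_sets: "n \<ge> 1 \<Longrightarrow> p \<in> l1 \<Longrightarrow> sets (\<kappa> n p) = sets X"
  using measurable_space[OF kernel, of n p] by (auto simp: space_prob_algebra)

lemma factor_law_sets: "n \<ge> 1 \<Longrightarrow> sets (factor_law X (\<kappa> n) (Q n)) = sets row_algebra"
  and factor_law_prob: "n \<ge> 1 \<Longrightarrow> prob_space (factor_law X (\<kappa> n) (Q n))"
proof -
  show "sets (factor_law X (\<kappa> n) (Q n)) = sets row_algebra" if n: "n \<ge> 1"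
    by (rule emeasure_factor_law(1)[OF kernel[OF n] Q_prob[OF n] Q_borel[OF n] sets.empty_sets finite.emptyI])
      simp
  show "prob_space (factor_law X (\<kappa> n) (Q n))" if n: "n \<ge> 1"
    by (rule emeasure_factor_law(2)[OF kernel[OF n] Q_prob[OF n] Q_borel[OF n] sets.empty_sets finite.emptyI])
      simp
qed

lemma distr_row:
  assumes n: "n \<ge> 1"
  shows "distr \<P> (factor_law X (\<kappa> n) (Q n)) (\<lambda>\<omega>. \<omega> n) = factor_law X (\<kappa> n) (Q n)"
  unfolding array_space_def using factor_law_prob n by (intro distr_PiM_component) auto

lemma row_measurable:
  assumes n: "n \<ge> 1"
  shows "(\<lambda>\<omega>. \<omega> n) \<in> \<P> \<rightarrow>\<^sub>M row_algebra"
proof -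
  have "(\<lambda>\<omega>. \<omega> n) \<in> \<P> \<rightarrow>\<^sub>M factor_law X (\<kappa> n) (Q n)"
    unfolding array_space_def using n by (intro measurable_component_singleton) simp
  then show ?thesis
    using measurable_cong_sets[OF refl factor_law_sets[OF n]] by blast
qed

lemma row_space:
  assumes "n \<ge> 1" "\<omega> \<in> space \<P>"
  shows "\<omega> n \<in> space row_algebra" "beta n \<omega> \<in> l1" "snd (\<omega> n) i \<in> space X"
proof -
  show *: "\<omega> n \<in> space row_algebra" by (rule measurable_space[OF row_measurable[OF assms(1)] assms(2)])
  then show "beta n \<omega> \<in> l1" "snd (\<omega> n) i \<in> space X"
    by (auto simp: beta_def space_pair_measure space_PiM PiE_iff)
qed

text \<open>
  The disintegration: given \<open>beta n = p\<close>, the row of observations is an i.i.d. sequence with law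
  \<open>\<kappa> n p\<close>. The conditional probability is moreover a measurable function of \<open>p\<close>, which
  \<open>conditional_bound\<close> below relies on.
\<close>

lemma emeasure_row:
  assumes n: "n \<ge> 1" and A: "A \<in> sets row_algebra"
  shows "emeasure \<P> {\<omega> \<in> space \<P>. \<omega> n \<in> A}
    = (\<integral>\<^sup>+p. emeasure (Pi\<^sub>M UNIV (\<lambda>_. \<kappa> n p)) {y \<in> space (Pi\<^sub>M UNIV (\<lambda>_. \<kappa> n p)). (p, y) \<in> A} \<partial>Q n)"
    and "(\<lambda>p. emeasure (Pi\<^sub>M UNIV (\<lambda>_. \<kappa> n p)) {y \<in> space (Pi\<^sub>M UNIV (\<lambda>_. \<kappa> n p)). (p, y) \<in> A})
      \<in> borel_measurable l1_borel"
proof -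
  let ?W = "factor_law X (\<kappa> n) (Q n)"
  let ?K = "\<lambda>p. distr (Pi\<^sub>M UNIV (\<lambda>_. \<kappa> n p)) row_algebra (Pair p)"
  note K = measurable_iid_kernel[OF kernel[OF n]]
  have Q': "Q n \<in> space (prob_algebra l1_borel)"
    using Q_prob Q_borel n by (simp add: space_prob_algebra)
  have eK: "emeasure (?K p) A
    = emeasure (Pi\<^sub>M UNIV (\<lambda>_. \<kappa> n p)) {y \<in> space (Pi\<^sub>M UNIV (\<lambda>_. \<kappa> n p)). (p, y) \<in> A}" if "p \<in> l1" for p
  proof -
    have "sets (Pi\<^sub>M (UNIV :: nat set) (\<lambda>_. \<kappa> n p)) = sets (Pi\<^sub>M UNIV (\<lambda>_. X))"
      using kernel_sets[OF n that] by (intro sets_PiM_cong) auto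
    then have "Pair p \<in> Pi\<^sub>M UNIV (\<lambda>_. \<kappa> n p) \<rightarrow>\<^sub>M row_algebra"
      using that by (simp cong: measurable_cong_sets)
    then show ?thesis by (subst emeasure_distr[OF _ A]) (auto intro!: arg_cong[where f="emeasure _"])
  qed
  have "emeasure \<P> {\<omega> \<in> space \<P>. \<omega> n \<in> A} = emeasure (distr \<P> ?W (\<lambda>\<omega>. \<omega> n)) A"
    using A factor_law_sets[OF n] row_measurable[OF n]
    by (subst emeasure_distr) (auto cong: measurable_cong_sets intro!: arg_cong[where f="emeasure _"])
  also have "\<dots> = (\<integral>\<^sup>+p. emeasure (?K p) A \<partial>Q n)"
    unfolding distr_row[OF n] unfolding factor_law_def by (rule emeasure_bind_prob_algebra[OF Q' K A])
  also have "\<dots> = (\<integral>\<^sup>+p. emeasure (Pi\<^sub>M UNIV (\<lambda>_. \<kappa> n p)) {y \<in> space (Pi\<^sub>M UNIV (\<lambda>_. \<kappa> n p)). (p, y) \<in> A} \<partial>Q n)"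
    using sets_eq_imp_space_eq[OF Q_borel[OF n]] by (intro nn_integral_cong eK) auto
  finally show "emeasure \<P> {\<omega> \<in> space \<P>. \<omega> n \<in> A} = \<dots>" .
  have "(\<lambda>p. emeasure (?K p) A) \<in> borel_measurable l1_borel"
    by (rule measurable_emeasure_kernel[OF measurable_prob_algebraD[OF K] A])
  then show "(\<lambda>p. emeasure (Pi\<^sub>M UNIV (\<lambda>_. \<kappa> n p)) {y \<in> space (Pi\<^sub>M UNIV (\<lambda>_. \<kappa> n p)). (p, y) \<in> A})
      \<in> borel_measurable l1_borel"
    using eK by (subst measurable_cong[where g="\<lambda>p. emeasure (?K p) A"]) auto
qed

lemma emeasure_beta:
  assumes n: "n \<ge> 1" and B: "B \<in> sets l1_borel"
  shows "emeasure \<P> {\<omega> \<in> space \<P>. beta n \<omega> \<in> B} = emeasure (Q n) B"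
proof -
  let ?A = "{z \<in> space row_algebra. fst z \<in> B}"
  have A: "?A \<in> sets row_algebra" using B by measurable
  have "emeasure \<P> {\<omega> \<in> space \<P>. beta n \<omega> \<in> B} = emeasure \<P> {\<omega> \<in> space \<P>. \<omega> n \<in> ?A}"
    using row_space(1)[OF n] by (intro arg_cong[where f="emeasure _"]) (auto simp: beta_def)
  also have "\<dots> = (\<integral>\<^sup>+p. indicator B p \<partial>Q n)"
    unfolding emeasure_row(1)[OF n A]
  proof (rule nn_integral_cong)
    fix p assume "p \<in> space (Q n)"
    then have p: "p \<in> l1" using sets_eq_imp_space_eq[OF Q_borel[OF n]] by simp
    interpret prob_space "Pi\<^sub>M (UNIV :: nat set) (\<lambda>_. \<kappa> n p)"
      using kernel_prob[OF n p] by (intro prob_space_PiM)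
    have "{y \<in> space (Pi\<^sub>M (UNIV :: nat set) (\<lambda>_. \<kappa> n p)). (p, y) \<in> ?A}
      = (if p \<in> B then space (Pi\<^sub>M UNIV (\<lambda>_. \<kappa> n p)) else {})"
      using p sets_eq_imp_space_eq[OF kernel_sets[OF n p]]
      by (auto simp: space_pair_measure space_PiM)
    then show "emeasure (Pi\<^sub>M UNIV (\<lambda>_. \<kappa> n p)) {y \<in> space (Pi\<^sub>M UNIV (\<lambda>_. \<kappa> n p)). (p, y) \<in> ?A}
      = indicator B p"
      by (simp add: emeasure_space_1)
  qed
  also have "\<dots> = emeasure (Q n) B" using B Q_borel[OF n] by simp
  finally show ?thesis .
qed

lemma nn_integral_marginal_law:
  assumes n: "n \<ge> 1" and h: "h \<in> borel_measurable X"
  shows "(\<integral>\<^sup>+x. h x \<partial>marginal_law X \<kappa> Q n) = (\<integral>\<^sup>+p. (\<integral>\<^sup>+x. h x \<partial>\<kappa> n p) \<partial>Q n)"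
proof -
  have "marginal_law X \<kappa> Q n = Q n \<bind> \<kappa> n"
  proof (rule measure_eqI)
    have Q': "Q n \<in> space (prob_algebra l1_borel)"
      using Q_prob Q_borel n by (simp add: space_prob_algebra)
    show sets: "sets (marginal_law X \<kappa> Q n) = sets (Q n \<bind> \<kappa> n)"
      using sets_bind'[OF Q' kernel[OF n]] by (simp add: marginal_law_def)
    fix B assume "B \<in> sets (marginal_law X \<kappa> Q n)"
    then have B: "B \<in> sets X" by (simp add: marginal_law_def)
    let ?A = "{z \<in> space row_algebra. snd z 1 \<in> B}"
    have A: "?A \<in> sets row_algebra"
    proof -
      have "(\<lambda>z. snd z 1) \<in> row_algebra \<rightarrow>\<^sub>M X" by measurable
      from measurable_sets[OF this B] show ?thesis by (simp add: vimage_def Int_def conj_commute)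
    qed
    have "obs 1 n \<in> \<P> \<rightarrow>\<^sub>M X"
      unfolding obs_def[abs_def]
      by (rule measurable_compose[OF measurable_compose[OF row_measurable[OF n] measurable_snd] measurable_component_singleton]) simp
    then have "emeasure (marginal_law X \<kappa> Q n) B = emeasure \<P> {\<omega> \<in> space \<P>. \<omega> n \<in> ?A}"
      unfolding marginal_law_def using B row_space(1)[OF n]
      by (subst emeasure_distr) (auto simp: obs_def intro!: arg_cong[where f="emeasure _"])
    also have "\<dots> = (\<integral>\<^sup>+p. emeasure (\<kappa> n p) B \<partial>Q n)"
      unfolding emeasure_row(1)[OF n A]
    proof (rule nn_integral_cong)
      fix p assume "p \<in> space (Q n)"
      then have p: "p \<in> l1" using sets_eq_imp_space_eq[OF Q_borel[OF n]] by simp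
      note sp = sets_eq_imp_space_eq[OF kernel_sets[OF n p]]
      have "{y \<in> space (Pi\<^sub>M (UNIV :: nat set) (\<lambda>_. \<kappa> n p)). (p, y) \<in> ?A}
        = (\<lambda>y. y 1) -` B \<inter> space (Pi\<^sub>M (UNIV :: nat set) (\<lambda>_. \<kappa> n p))"
        using p sp by (auto simp: space_pair_measure space_PiM)
      also have "emeasure (Pi\<^sub>M UNIV (\<lambda>_. \<kappa> n p)) \<dots>
        = emeasure (distr (Pi\<^sub>M (UNIV :: nat set) (\<lambda>_. \<kappa> n p)) (\<kappa> n p) (\<lambda>y. y 1)) B"
        using B kernel_sets[OF n p] by (subst emeasure_distr) auto
      also have "\<dots> = emeasure (\<kappa> n p) B"
        using kernel_prob[OF n p] by (subst distr_PiM_component) auto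
      finally show "emeasure (Pi\<^sub>M UNIV (\<lambda>_. \<kappa> n p)) {y \<in> space (Pi\<^sub>M UNIV (\<lambda>_. \<kappa> n p)). (p, y) \<in> ?A}
        = emeasure (\<kappa> n p) B" .
    qed
    also have "\<dots> = emeasure (Q n \<bind> \<kappa> n) B"
      by (rule emeasure_bind_prob_algebra[OF Q' kernel[OF n] B, symmetric])
    finally show "emeasure (marginal_law X \<kappa> Q n) B = emeasure (Q n \<bind> \<kappa> n) B" .
  qed
  then show ?thesis
    using h measurable_prob_algebraD[OF kernel[OF n]] Q_borel[OF n]
    by (simp add: nn_integral_bind[where B=X] cong: measurable_cong_sets)
qed

text \<open>
  The set \<open>Bad\<close> need not be measurable; in the application it is defined by bracketing numbers. What
  saves the Fubini argument is that the conditional probability \<open>\<phi>\<close> and its bound \<open>\<psi>\<close> are measurable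
  functions of the weights: the set where \<open>\<phi>\<close> exceeds \<open>\<psi>\<close> is measurable and contained in \<open>Bad\<close>, so
  its probability is at most the outer probability of \<open>Bad\<close>. On this set the trivial bound
  \<open>\<phi> \<le> 1\<close> suffices.
\<close>

lemma conditional_bound:
  assumes n: "n \<ge> 1" and A: "A \<in> sets row_algebra" and \<psi>: "\<psi> \<in> borel_measurable l1_borel"
    and le: "\<And>p. p \<in> l1 \<Longrightarrow> p \<notin> Bad \<Longrightarrow>
      emeasure (Pi\<^sub>M UNIV (\<lambda>_. \<kappa> n p)) {y \<in> space (Pi\<^sub>M UNIV (\<lambda>_. \<kappa> n p)). (p, y) \<in> A} \<le> \<psi> p"
  shows "emeasure \<P> {\<omega> \<in> space \<P>. \<omega> n \<in> A}
    \<le> (\<integral>\<^sup>+p. \<psi> p \<partial>Q n) + outer_measure_of \<P> {\<omega> \<in> space \<P>. beta n \<omega> \<in> Bad}"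
proof -
  define \<phi> where "\<phi> p = emeasure (Pi\<^sub>M UNIV (\<lambda>_. \<kappa> n p)) {y \<in> space (Pi\<^sub>M UNIV (\<lambda>_. \<kappa> n p)). (p, y) \<in> A}" for p
  have \<phi>: "\<phi> \<in> borel_measurable l1_borel" unfolding \<phi>_def[abs_def] by (rule emeasure_row(2)[OF n A])
  define B where "B = {p \<in> space l1_borel. \<psi> p < \<phi> p}"
  have B: "B \<in> sets l1_borel" unfolding B_def using \<phi> \<psi> by measurable
  note sp = sets_eq_imp_space_eq[OF Q_borel[OF n]]
  have "emeasure \<P> {\<omega> \<in> space \<P>. \<omega> n \<in> A} = (\<integral>\<^sup>+p. \<phi> p \<partial>Q n)"
    unfolding \<phi>_def by (rule emeasure_row(1)[OF n A])
  also have "\<dots> \<le> (\<integral>\<^sup>+p. \<psi> p + indicator B p \<partial>Q n)"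
  proof (rule nn_integral_mono)
    fix p assume "p \<in> space (Q n)"
    then have p: "p \<in> l1" using sp by simp
    interpret prob_space "Pi\<^sub>M (UNIV :: nat set) (\<lambda>_. \<kappa> n p)"
      using kernel_prob[OF n p] by (intro prob_space_PiM)
    have "\<phi> p \<le> 1" unfolding \<phi>_def by (rule emeasure_le_1)
    then show "\<phi> p \<le> \<psi> p + indicator B p"
      using p by (cases "p \<in> B") (auto simp: B_def intro: order_trans add_increasing)
  qed
  also have "\<dots> = (\<integral>\<^sup>+p. \<psi> p \<partial>Q n) + emeasure (Q n) B"
    using B \<psi> Q_borel[OF n] by (subst nn_integral_add) (auto cong: measurable_cong_sets)
  also have "emeasure (Q n) B = outer_measure_of \<P> {\<omega> \<in> space \<P>. beta n \<omega> \<in> B}"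
  proof -
    have "beta n \<in> \<P> \<rightarrow>\<^sub>M l1_borel"
      unfolding beta_def[abs_def] by (rule measurable_compose[OF row_measurable[OF n] measurable_fst])
    then have "{\<omega> \<in> space \<P>. beta n \<omega> \<in> B} \<in> sets \<P>" using B by measurable
    then show ?thesis using emeasure_beta[OF n B] by simp
  qed
  also have "\<dots> \<le> outer_measure_of \<P> {\<omega> \<in> space \<P>. beta n \<omega> \<in> Bad}"
    using le by (intro outer_measure_of_mono) (auto simp: B_def \<phi>_def not_less[symmetric])
  finally show ?thesis by simp
qed

lemma centred_sum_measurable:
  assumes n: "n \<ge> 1" and g: "g \<in> borel_measurable X"
  shows "(\<lambda>z. centred_sum (\<kappa> n (fst z)) (fst z) g (snd z)) \<in> borel_measurable row_algebra"
proof -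
  note l1_coordinate_measurable[measurable] g[measurable]
  note measurable_prob_algebraD[OF kernel[OF n], measurable]
  note integral_measurable_subprob_algebra[OF g, measurable]
  show ?thesis unfolding centred_sum_def by measurable
qed

lemma weighted_excess_measurable:
  assumes n: "n \<ge> 1" and h: "h \<in> borel_measurable X"
  shows "(\<lambda>z. weighted_excess (\<kappa> n (fst z)) (fst z) h (snd z)) \<in> borel_measurable row_algebra"
proof -
  note l1_coordinate_measurable[measurable] h[measurable]
  note measurable_prob_algebraD[OF kernel[OF n], measurable]
  note nn_integral_measurable_subprob_algebra[OF h, measurable]
  show ?thesis unfolding weighted_excess_def by measurable
qed

lemma G_trunc_eq_centred_sum:
  "G_trunc \<kappa> F M n \<omega> f = centred_sum (\<kappa> n (beta n \<omega>)) (beta n \<omega>) (truncated F M f) (snd (\<omega> n))"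
  by (simp add: G_trunc_def centred_sum_def obs_def)

section \<open>The uniform law of large numbers\<close>

text \<open>
  The quantitative core, for a single row. For weights outside \<open>Bad\<close> the conditional probability of
  \<open>A\<close> is bounded by the maximal inequality, which gives the first summand, and by Markov's
  inequality for the excess, which gives the second one after integration over the weights.
\<close>

lemma row_estimate:
  assumes n: "n \<ge> 1" and F: "pointwise_measurable X F F0" and M: "0 \<le> M"
    and L: "0 \<le> L" and \<epsilon>: "0 \<le> \<epsilon>" "L * \<epsilon> \<le> r" and r: "0 < r" and K: "0 \<le> K" and \<delta>: "0 \<le> \<delta>"
  defines "h \<equiv> \<lambda>x. envelope F x * indicator {x. ennreal M \<le> envelope F x} x"
  defines "A \<equiv> {z \<in> space row_algebra.
      (\<exists>f\<in>F0. 2 * r < \<bar>centred_sum (\<kappa> n (fst z)) (fst z) (truncated F M f) (snd z)\<bar>)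
      \<or> ennreal r \<le> weighted_excess (\<kappa> n (fst z)) (fst z) h (snd z)}"
  defines "Bad \<equiv> {p. p \<notin> l1_pos} \<union> {p. ennreal L < ennreal (seq_norm 1 p)}
      \<union> {p. ennreal \<delta> < ennreal (seq_norm 2 p)}
      \<union> {p. ennreal K < ennreal_of_enat (bracketing_number X \<epsilon> F (L1_norm (\<kappa> n p)))}"
  shows "emeasure \<P> {\<omega> \<in> space \<P>. \<omega> n \<in> A}
    \<le> ennreal (8 * K * M\<^sup>2 * \<delta>\<^sup>2 / r\<^sup>2) + ennreal (2 * L / r) * (\<integral>\<^sup>+x. h x \<partial>marginal_law X \<kappa> Q n)
      + outer_measure_of \<P> {\<omega> \<in> space \<P>. beta n \<omega> \<in> Bad}"
    and "A \<in> sets row_algebra"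
proof -
  note FD = pointwise_measurableD[OF F]
  have h: "h \<in> borel_measurable X"
    unfolding h_def using envelope_measurable[OF F] envelope_level_sets(2)[OF F]
    by (intro borel_measurable_times_ennreal) auto
  show A: "A \<in> sets row_algebra"
  proof -
    note weighted_excess_measurable[OF n h, measurable]
    have [measurable]: "f \<in> F0 \<Longrightarrow>
      (\<lambda>z. centred_sum (\<kappa> n (fst z)) (fst z) (truncated F M f) (snd z)) \<in> borel_measurable row_algebra" for f
      using FD(2) by (intro centred_sum_measurable[OF n] truncated_measurable[OF F]) auto
    have "{z \<in> space row_algebra. \<exists>f\<in>F0. 2 * r < \<bar>centred_sum (\<kappa> n (fst z)) (fst z) (truncated F M f) (snd z)\<bar>}
      = (\<Union>f\<in>F0. {z \<in> space row_algebra. 2 * r < \<bar>centred_sum (\<kappa> n (fst z)) (fst z) (truncated F M f) (snd z)\<bar>})"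
      by auto
    also have "\<dots> \<in> sets row_algebra"
      using FD(1) by (intro sets.countable_UN'') measurable
    finally have 1: "{z \<in> space row_algebra. \<exists>f\<in>F0. 2 * r < \<bar>centred_sum (\<kappa> n (fst z)) (fst z) (truncated F M f) (snd z)\<bar>}
      \<in> sets row_algebra" .
    have "{z \<in> space row_algebra. ennreal r \<le> weighted_excess (\<kappa> n (fst z)) (fst z) h (snd z)} \<in> sets row_algebra"
      by measurable
    from sets.sets_Collect_disj[OF this 1] show ?thesis unfolding A_def .
  qed
  define \<psi> where "\<psi> p = ennreal (8 * K * M\<^sup>2 * \<delta>\<^sup>2 / r\<^sup>2) + ennreal (2 * L / r) * (\<integral>\<^sup>+x. h x \<partial>\<kappa> n p)" for p
  have mh: "(\<lambda>p. \<integral>\<^sup>+x. h x \<partial>\<kappa> n p) \<in> borel_measurable l1_borel"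
    by (rule measurable_compose[OF measurable_prob_algebraD[OF kernel[OF n]] nn_integral_measurable_subprob_algebra[OF h]])
  have \<psi>: "\<psi> \<in> borel_measurable l1_borel" unfolding \<psi>_def[abs_def] using mh by measurable
  have "emeasure \<P> {\<omega> \<in> space \<P>. \<omega> n \<in> A}
    \<le> (\<integral>\<^sup>+p. \<psi> p \<partial>Q n) + outer_measure_of \<P> {\<omega> \<in> space \<P>. beta n \<omega> \<in> Bad}"
  proof (rule conditional_bound[OF n A \<psi>])
    fix p assume p: "p \<in> l1" and good: "p \<notin> Bad"
    let ?D = "\<kappa> n p" and ?P = "Pi\<^sub>M (UNIV :: nat set) (\<lambda>_. \<kappa> n p)"
    note D = kernel_prob[OF n p] kernel_sets[OF n p]
    have pos: "p \<in> l1_pos" using good by (auto simp: Bad_def)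
    have sL: "suminf p \<le> L"
      using good L seq_norm_1_l1_pos[OF pos] by (auto simp: Bad_def not_less ennreal_le_iff)
    have s2: "(\<Sum>i. (p i)\<^sup>2) \<le> \<delta>\<^sup>2"
    proof -
      have "seq_norm 2 p \<le> \<delta>" using good \<delta> by (auto simp: Bad_def not_less ennreal_le_iff)
      then have "(seq_norm 2 p)\<^sup>2 \<le> \<delta>\<^sup>2" by (intro power_mono) (auto simp: seq_norm_def)
      then show ?thesis using seq_norm_2_l1[OF p] by simp
    qed
    have N: "ennreal_of_enat (bracketing_number X \<epsilon> F (L1_norm ?D)) \<le> ennreal K"
      using good by (auto simp: Bad_def not_less)
    obtain S where S: "finite S" "real (card S) \<le> K"
      "\<And>l u. (l, u) \<in> S \<Longrightarrow> l \<in> borel_measurable X" "\<And>l u. (l, u) \<in> S \<Longrightarrow> u \<in> borel_measurable X"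
      "\<And>l u. (l, u) \<in> S \<Longrightarrow> L1_norm ?D (\<lambda>x. u x - l x) < ennreal \<epsilon>"
      "F \<subseteq> (\<Union>(l, u)\<in>S. bracket X l u)"
      by (rule bracketing_number_attained[OF N K]) blast
    let ?E1 = "{y \<in> space ?P. \<exists>f\<in>F0. 2 * r < \<bar>centred_sum ?D p (truncated F M f) y\<bar>}"
    let ?E2 = "{y \<in> space ?P. ennreal r \<le> weighted_excess ?D p h y}"
    have hD: "h \<in> borel_measurable ?D" using h measurable_cong_sets[OF D(2) refl] by auto
    have tD: "truncated F M f \<in> borel_measurable ?D" if "f \<in> F0" for f
      using truncated_measurable[OF F, of f M] FD(2) that measurable_cong_sets[OF D(2) refl] by auto
    have E1m: "?E1 \<in> sets ?P"
    proof -
      have "?E1 = (\<Union>f\<in>F0. {y \<in> space ?P. 2 * r < \<bar>centred_sum ?D p (truncated F M f) y\<bar>})" by auto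
      also have "\<dots> \<in> sets ?P"
      proof (rule sets.countable_UN''[OF FD(1)])
        fix f assume "f \<in> F0"
        note tD[OF this, measurable]
        show "{y \<in> space ?P. 2 * r < \<bar>centred_sum ?D p (truncated F M f) y\<bar>} \<in> sets ?P"
          unfolding centred_sum_def by measurable
      qed
      finally show ?thesis .
    qed
    have E2m: "?E2 \<in> sets ?P"
    proof -
      note hD[measurable]
      show ?thesis unfolding weighted_excess_def by measurable
    qed
    have "suminf p * \<epsilon> \<le> r" using mult_right_mono[OF sL \<epsilon>(1)] \<epsilon>(2) by simp
    then have "emeasure ?P ?E1 \<le> ennreal (8 * real (card S) * M\<^sup>2 * (\<Sum>i. (p i)\<^sup>2) / r\<^sup>2)"
      by (intro maximal_inequality[OF D pos F M S(1,3,4,5,6) _ r])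
    also have "\<dots> \<le> ennreal (8 * K * M\<^sup>2 * \<delta>\<^sup>2 / r\<^sup>2)"
      using S(2) s2 K suminf_nonneg[OF l1_square_summable[OF p]]
      by (intro ennreal_leI divide_right_mono mult_mono) auto
    finally have E1: "emeasure ?P ?E1 \<le> ennreal (8 * K * M\<^sup>2 * \<delta>\<^sup>2 / r\<^sup>2)" .
    have "emeasure ?P {y \<in> space ?P. (p, y) \<in> A} \<le> emeasure ?P (?E1 \<union> ?E2)"
      using E1m E2m by (intro emeasure_mono) (auto simp: A_def)
    also have "\<dots> \<le> emeasure ?P ?E1 + emeasure ?P ?E2"
      by (rule emeasure_subadditive[OF E1m E2m])
    also have "\<dots> \<le> \<psi> p"
      unfolding \<psi>_def
      by (intro add_mono E1 weighted_excess_Markov[OF D(1) pos sL hD r])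
    finally show "emeasure ?P {y \<in> space ?P. (p, y) \<in> A} \<le> \<psi> p" .
  qed
  also have "(\<integral>\<^sup>+p. \<psi> p \<partial>Q n) = ennreal (8 * K * M\<^sup>2 * \<delta>\<^sup>2 / r\<^sup>2)
      + ennreal (2 * L / r) * (\<integral>\<^sup>+x. h x \<partial>marginal_law X \<kappa> Q n)"
  proof -
    interpret Q: prob_space "Q n" using Q_prob n by simp
    have "(\<lambda>p. \<integral>\<^sup>+x. h x \<partial>\<kappa> n p) \<in> borel_measurable (Q n)"
      using mh measurable_cong_sets[OF Q_borel[OF n] refl] by auto
    then show ?thesis
      unfolding \<psi>_def nn_integral_marginal_law[OF n h]
      by (simp add: nn_integral_add nn_integral_cmult Q.emeasure_space_1)
  qed
  finally show "emeasure \<P> {\<omega> \<in> space \<P>. \<omega> n \<in> A}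
    \<le> ennreal (8 * K * M\<^sup>2 * \<delta>\<^sup>2 / r\<^sup>2) + ennreal (2 * L / r) * (\<integral>\<^sup>+x. h x \<partial>marginal_law X \<kappa> Q n)
      + outer_measure_of \<P> {\<omega> \<in> space \<P>. beta n \<omega> \<in> Bad}" .
qed

text \<open>
  Triangle inequality through two truncations: from \<open>G\<close> to the level \<open>M'\<close> by convergence of the
  truncations, from \<open>M'\<close> down to \<open>M\<close> by the excess, and at level \<open>M\<close> by the bound on the separant.
\<close>

lemma G_bounded_off_exceptional_sets:
  assumes n: "n \<ge> 1" and F: "pointwise_measurable X F F0" and M: "0 \<le> M" "M \<le> M'"
    and r: "0 < r" and \<omega>: "\<omega> \<in> space \<P>" and pos: "beta n \<omega> \<in> l1_pos"
    and close: "sup_norm F (\<lambda>f. G_trunc \<kappa> F M' n \<omega> f - G \<omega> f) \<le> ennreal r"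
    and F0: "\<And>f. f \<in> F0 \<Longrightarrow> \<bar>G_trunc \<kappa> F M n \<omega> f\<bar> \<le> 2 * r"
    and excess: "weighted_excess (\<kappa> n (beta n \<omega>)) (beta n \<omega>)
      (\<lambda>x. envelope F x * indicator {x. ennreal M \<le> envelope F x} x) (snd (\<omega> n)) \<le> ennreal r"
  shows "sup_norm F (G \<omega>) \<le> ennreal (4 * r)"
  unfolding sup_norm_def
proof (rule SUP_least)
  fix f assume f: "f \<in> F"
  note D = kernel_prob[OF n row_space(2)[OF n \<omega>]] kernel_sets[OF n row_space(2)[OF n \<omega>]]
  have y: "snd (\<omega> n) i \<in> space (\<kappa> n (beta n \<omega>))" for i
    using row_space(3)[OF n \<omega>] sets_eq_imp_space_eq[OF D(2)] by simp
  have "ennreal \<bar>G_trunc \<kappa> F M' n \<omega> f - G \<omega> f\<bar> \<le> ennreal r"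
    using close f by (auto simp: sup_norm_def SUP_le_iff)
  then have 1: "\<bar>G_trunc \<kappa> F M' n \<omega> f - G \<omega> f\<bar> \<le> r" using r by (simp add: ennreal_le_iff)
  have "ennreal \<bar>G_trunc \<kappa> F M' n \<omega> f - G_trunc \<kappa> F M n \<omega> f\<bar> \<le> ennreal r"
    unfolding G_trunc_eq_centred_sum
    using truncation_change_le_excess[OF D pos F M f y] excess by (rule order_trans)
  then have 2: "\<bar>G_trunc \<kappa> F M' n \<omega> f - G_trunc \<kappa> F M n \<omega> f\<bar> \<le> r" using r by (simp add: ennreal_le_iff)
  have 3: "\<bar>G_trunc \<kappa> F M n \<omega> f\<bar> \<le> 2 * r"
  proof (rule ccontr)
    assume "\<not> ?thesis"
    then have "\<exists>f\<in>F0. 2 * r < \<bar>G_trunc \<kappa> F M n \<omega> f\<bar>"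
      unfolding G_trunc_eq_centred_sum
      by (intro separant_exceeds[OF D row_space(2)[OF n \<omega>] F M(1) f y]) simp
    then show False using F0 by force
  qed
  show "ennreal \<bar>G \<omega> f\<bar> \<le> ennreal (4 * r)"
    using 1 2 3 by (intro ennreal_leI) linarith
qed

text \<open>
  Since \<open>arctan\<close> is increasing, convergence of the outer expectations of the \<open>arctan\<close> of the distance
  gives convergence in outer probability. The level \<open>M'\<close> may depend on
  the row; it is taken above the level \<open>M\<close>, common to all rows, at which the excess is measured.
\<close>

lemma truncations_approximate_G:
  assumes G: "is_G X \<kappa> Q F n G" and r: "0 < r" and \<eta>: "0 < \<eta>"
  obtains M' where "M \<le> M'"
    "outer_measure_of \<P> {\<omega> \<in> space \<P>. ennreal r < sup_norm F (\<lambda>f. G_trunc \<kappa> F M' n \<omega> f - G \<omega> f)} \<le> ennreal \<eta>"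
proof -
  let ?Z = "\<lambda>M \<omega>. arctan_ennreal (sup_norm F (\<lambda>f. G_trunc \<kappa> F M n \<omega> f - G \<omega> f))"
  have a: "0 < arctan r" using r by simp
  have "((\<lambda>M. outer_expectation \<P> (?Z M)) \<longlongrightarrow> 0) at_top"
    using G by (simp add: is_G_def)
  then have "eventually (\<lambda>M. outer_expectation \<P> (?Z M) < ennreal (arctan r * \<eta>)) at_top"
    using a \<eta> by (intro order_tendstoD(2)) (auto simp: ennreal_zero_less_mult_iff)
  then have "eventually (\<lambda>M'. M \<le> M' \<and> outer_expectation \<P> (?Z M') < ennreal (arctan r * \<eta>)) at_top"
    using eventually_ge_at_top[of M] by eventually_elim simp
  then obtain M' where M': "M \<le> M'" "outer_expectation \<P> (?Z M') < ennreal (arctan r * \<eta>)"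
    using eventually_happens'[OF trivial_limit_at_top_linorder] by blast
  have arc: "ennreal (arctan r) \<le> arctan_ennreal z" if "ennreal r < z" for z
  proof (cases z)
    case (real t)
    then show ?thesis using that r
      by (auto simp: arctan_ennreal_def ennreal_less_iff arctan_le_iff intro!: ennreal_leI)
  next
    case top
    then show ?thesis using arctan_ubound[of r] by (simp add: arctan_ennreal_def ennreal_leI)
  qed
  have "outer_measure_of \<P> {\<omega> \<in> space \<P>. ennreal r < sup_norm F (\<lambda>f. G_trunc \<kappa> F M' n \<omega> f - G \<omega> f)}
    \<le> outer_measure_of \<P> {\<omega> \<in> space \<P>. ennreal (arctan r) \<le> ?Z M' \<omega>}"
    using arc by (intro outer_measure_of_mono) auto
  also have "\<dots> \<le> ennreal \<eta>"
    by (rule outer_expectation_Markov[OF a M'(2)])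
  finally show ?thesis using M'(1) by (intro that) auto
qed

end

theorem theorem1:
  fixes X :: "'a measure"
    and \<kappa> :: "nat \<Rightarrow> (nat \<Rightarrow> real) \<Rightarrow> 'a measure"
    and Q :: "nat \<Rightarrow> (nat \<Rightarrow> real) measure"
    and F F0 :: "('a \<Rightarrow> real) set"
    and G :: "nat \<Rightarrow> (nat \<Rightarrow> (nat \<Rightarrow> real) \<times> (nat \<Rightarrow> 'a)) \<Rightarrow> ('a \<Rightarrow> real) \<Rightarrow> real"
  assumes kernel: "\<And>n. n \<ge> 1 \<Longrightarrow> \<kappa> n \<in> l1_borel \<rightarrow>\<^sub>M prob_algebra X"
    and Q_prob: "\<And>n. n \<ge> 1 \<Longrightarrow> prob_space (Q n)"
    and Q_borel: "\<And>n. n \<ge> 1 \<Longrightarrow> sets (Q n) = sets l1_borel"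
    and F: "pointwise_measurable X F F0"
    and F_integrable: "\<And>n. n \<ge> 1 \<Longrightarrow> (\<integral>\<^sup>+y. envelope F y \<partial>marginal_law X \<kappa> Q n) < \<infinity>"
    and G: "\<And>n. n \<ge> 1 \<Longrightarrow> is_G X \<kappa> Q F n (G n)"
    and tails: "((\<lambda>M::real. limsup (\<lambda>n.
        \<integral>\<^sup>+y. envelope F y * indicator {y. envelope F y \<ge> ennreal M} y
          \<partial>marginal_law X \<kappa> Q n)) \<longlongrightarrow> 0) at_top"
    and brackets: "\<And>\<epsilon>::real. \<epsilon> > 0 \<Longrightarrow> bounded_in_prob (array_space X \<kappa> Q)
        (\<lambda>n \<omega>. ennreal_of_enat (bracketing_number X \<epsilon> F (L1_norm (\<kappa> n (beta n \<omega>)))))"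
    and beta_pos: "\<And>n. n \<ge> 1 \<Longrightarrow> AE \<omega> in array_space X \<kappa> Q. beta n \<omega> \<in> l1_pos"
    and beta_l1: "bounded_in_prob (array_space X \<kappa> Q) (\<lambda>n \<omega>. ennreal (seq_norm 1 (beta n \<omega>)))"
    and beta_l2: "tendsto_zero_in_prob (array_space X \<kappa> Q)
        (\<lambda>n \<omega>. ennreal (seq_norm 2 (beta n \<omega>)))"
  shows "tendsto_zero_in_prob (array_space X \<kappa> Q) (\<lambda>n \<omega>. sup_norm F (G n \<omega>))"
proof -
  interpret triangular_array X \<kappa> Q
    using kernel Q_prob Q_borel by (rule triangular_array.intro)
  show ?thesis
    unfolding tendsto_zero_in_prob_def
  proof (intro allI impI ennreal_tendsto_0I)
    fix s e :: real assume s: "0 < s" and e: "0 < e"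
    \<comment> \<open>The distance \<open>s\<close> is divided as \<open>r + r + 2 * r\<close>; the probability \<open>e\<close> is divided among six
      events: maximal inequality, tail, the two norms of the weights, bracketing number, and
      approximation of \<open>G n\<close> by a truncation.\<close>
    define r where "r = s / 4"
    define \<eta> where "\<eta> = e / 6"
    have r: "0 < r" and \<eta>: "0 < \<eta>" using s e by (auto simp: r_def \<eta>_def)
    obtain L where L: "0 < L"
      and ev_L: "eventually (\<lambda>n. outer_measure_of \<P> {\<omega> \<in> space \<P>. ennreal L < ennreal (seq_norm 1 (beta n \<omega>))} \<le> ennreal \<eta>) sequentially"
      using bounded_in_probD[OF beta_l1 \<eta>] .
    define h where "h M x = envelope F x * indicator {x. ennreal M \<le> envelope F x} x" for M x
    have "0 < \<eta> * r / (2 * L)" using \<eta> r L by simp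
    then have "eventually (\<lambda>M. limsup (\<lambda>n. \<integral>\<^sup>+x. h M x \<partial>marginal_law X \<kappa> Q n) < ennreal (\<eta> * r / (2 * L))) at_top"
      using tails unfolding h_def by (intro order_tendstoD(2)) auto
    then have "eventually (\<lambda>M. 0 < M \<and> limsup (\<lambda>n. \<integral>\<^sup>+x. h M x \<partial>marginal_law X \<kappa> Q n) < ennreal (\<eta> * r / (2 * L))) at_top"
      using eventually_gt_at_top[of 0] by eventually_elim simp
    then obtain M where M: "0 < M"
      and M_tail: "limsup (\<lambda>n. \<integral>\<^sup>+x. h M x \<partial>marginal_law X \<kappa> Q n) < ennreal (\<eta> * r / (2 * L))"
      using eventually_happens'[OF trivial_limit_at_top_linorder] by blast
    note ev_M = Limsup_lessD[OF M_tail]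
    \<comment> \<open>The bracket size is such that weights of total mass at most \<open>L\<close> shift the centring by at most \<open>r\<close>.\<close>
    define \<epsilon> where "\<epsilon> = r / L"
    have \<epsilon>: "0 < \<epsilon>" "L * \<epsilon> \<le> r" using r L by (auto simp: \<epsilon>_def)
    obtain K where K: "0 < K"
      and ev_K: "eventually (\<lambda>n. outer_measure_of \<P> {\<omega> \<in> space \<P>. ennreal K <
        ennreal_of_enat (bracketing_number X \<epsilon> F (L1_norm (\<kappa> n (beta n \<omega>))))} \<le> ennreal \<eta>) sequentially"
      using bounded_in_probD[OF brackets[OF \<epsilon>(1)] \<eta>] .
    \<comment> \<open>Chosen last, because it has to beat both the number of brackets and the truncation level in
      the maximal inequality.\<close>
    define \<delta> where "\<delta> = sqrt (\<eta> * r\<^sup>2 / (8 * K * M\<^sup>2))"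
    have \<delta>: "0 < \<delta>" "8 * K * M\<^sup>2 * \<delta>\<^sup>2 / r\<^sup>2 = \<eta>"
      using \<eta> r K M by (auto simp: \<delta>_def)
    have "(\<lambda>n. outer_measure_of \<P> {\<omega> \<in> space \<P>. ennreal \<delta> < ennreal (seq_norm 2 (beta n \<omega>))}) \<longlonglongrightarrow> 0"
      using beta_l2 \<delta>(1) unfolding tendsto_zero_in_prob_def by blast
    then have ev_\<delta>: "eventually (\<lambda>n. outer_measure_of \<P> {\<omega> \<in> space \<P>. ennreal \<delta> < ennreal (seq_norm 2 (beta n \<omega>))} < ennreal \<eta>) sequentially"
      using \<eta> by (intro order_tendstoD(2)) auto
    show "eventually (\<lambda>n. outer_measure_of \<P> {\<omega> \<in> space \<P>. ennreal s < sup_norm F (G n \<omega>)} \<le> ennreal e) sequentially"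
      using ev_L ev_M ev_K ev_\<delta> eventually_ge_at_top[of 1]
    proof eventually_elim
      case (elim n)
      note n = elim(5)
      let ?NP = "{\<omega> \<in> space \<P>. beta n \<omega> \<notin> l1_pos}"
      let ?BL = "{\<omega> \<in> space \<P>. ennreal L < ennreal (seq_norm 1 (beta n \<omega>))}"
      let ?B\<delta> = "{\<omega> \<in> space \<P>. ennreal \<delta> < ennreal (seq_norm 2 (beta n \<omega>))}"
      let ?BK = "{\<omega> \<in> space \<P>. ennreal K < ennreal_of_enat (bracketing_number X \<epsilon> F (L1_norm (\<kappa> n (beta n \<omega>))))}"
      define A where "A = {z \<in> space row_algebra.
        (\<exists>f\<in>F0. 2 * r < \<bar>centred_sum (\<kappa> n (fst z)) (fst z) (truncated F M f) (snd z)\<bar>)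
        \<or> ennreal r \<le> weighted_excess (\<kappa> n (fst z)) (fst z) (h M) (snd z)}"
      define Bad where "Bad = {p. p \<notin> l1_pos} \<union> {p. ennreal L < ennreal (seq_norm 1 p)}
        \<union> {p. ennreal \<delta> < ennreal (seq_norm 2 p)}
        \<union> {p. ennreal K < ennreal_of_enat (bracketing_number X \<epsilon> F (L1_norm (\<kappa> n p)))}"
      have NP: "outer_measure_of \<P> ?NP = 0"
        using beta_pos[OF n] by (rule outer_measure_of_AE_zero)
      have "{\<omega> \<in> space \<P>. beta n \<omega> \<in> Bad} = ((?NP \<union> ?BL) \<union> ?B\<delta>) \<union> ?BK"
        by (auto simp: Bad_def)
      also have "outer_measure_of \<P> \<dots> \<le> ((0 + ennreal \<eta>) + ennreal \<eta>) + ennreal \<eta>"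
        using NP elim(1,3,4)
        by (intro order.trans[OF outer_measure_of_Un_le] add_mono) auto
      finally have bad: "outer_measure_of \<P> {\<omega> \<in> space \<P>. beta n \<omega> \<in> Bad} \<le> ennreal (3 * \<eta>)"
        using \<eta> by (simp add: ennreal_plus[symmetric] del: ennreal_plus)
      have tail: "ennreal (2 * L / r) * (\<integral>\<^sup>+x. h M x \<partial>marginal_law X \<kappa> Q n) \<le> ennreal \<eta>"
      proof -
        have "ennreal (2 * L / r) * (\<integral>\<^sup>+x. h M x \<partial>marginal_law X \<kappa> Q n)
          \<le> ennreal (2 * L / r) * ennreal (\<eta> * r / (2 * L))"
          using elim(2) by (intro mult_left_mono) auto
        also have "\<dots> = ennreal \<eta>" using L r by (simp add: ennreal_mult'[symmetric])
        finally show ?thesis .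
      qed
      note row = row_estimate[OF n F less_imp_le[OF M] less_imp_le[OF L] less_imp_le[OF \<epsilon>(1)] \<epsilon>(2) r
          less_imp_le[OF K] less_imp_le[OF \<delta>(1)]]
      have "emeasure \<P> {\<omega> \<in> space \<P>. \<omega> n \<in> A}
        \<le> ennreal (8 * K * M\<^sup>2 * \<delta>\<^sup>2 / r\<^sup>2) + ennreal (2 * L / r) * (\<integral>\<^sup>+x. h M x \<partial>marginal_law X \<kappa> Q n)
        + outer_measure_of \<P> {\<omega> \<in> space \<P>. beta n \<omega> \<in> Bad}"
        unfolding A_def h_def Bad_def by (rule row(1))
      also have "\<dots> \<le> ennreal \<eta> + ennreal \<eta> + ennreal (3 * \<eta>)"
        unfolding \<delta>(2) using tail bad by (intro add_mono order_refl)
      also have "\<dots> = ennreal (5 * \<eta>)"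
        using \<eta> by (simp add: ennreal_plus[symmetric] del: ennreal_plus)
      finally have PA: "emeasure \<P> {\<omega> \<in> space \<P>. \<omega> n \<in> A} \<le> ennreal (5 * \<eta>)" .
      have A: "A \<in> sets row_algebra" unfolding A_def h_def by (rule row(2))
      have EA: "{\<omega> \<in> space \<P>. \<omega> n \<in> A} \<in> sets \<P>"
        using measurable_sets[OF row_measurable[OF n] A] by (simp add: vimage_def Int_def conj_commute)
      obtain M' where M': "M \<le> M'" "outer_measure_of \<P>
          {\<omega> \<in> space \<P>. ennreal r < sup_norm F (\<lambda>f. G_trunc \<kappa> F M' n \<omega> f - G n \<omega> f)} \<le> ennreal \<eta>"
        using truncations_approximate_G[OF G[OF n] r \<eta>] .
      let ?C = "{\<omega> \<in> space \<P>. ennreal r < sup_norm F (\<lambda>f. G_trunc \<kappa> F M' n \<omega> f - G n \<omega> f)}"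
      have "{\<omega> \<in> space \<P>. ennreal s < sup_norm F (G n \<omega>)} \<subseteq> ({\<omega> \<in> space \<P>. \<omega> n \<in> A} \<union> ?NP) \<union> ?C"
      proof (rule subsetI, rule ccontr)
        fix \<omega> assume \<omega>: "\<omega> \<in> {\<omega> \<in> space \<P>. ennreal s < sup_norm F (G n \<omega>)}"
          and "\<omega> \<notin> ({\<omega> \<in> space \<P>. \<omega> n \<in> A} \<union> ?NP) \<union> ?C"
        then have sp: "\<omega> \<in> space \<P>" and notA: "\<omega> n \<notin> A" and pos: "beta n \<omega> \<in> l1_pos"
          and close: "sup_norm F (\<lambda>f. G_trunc \<kappa> F M' n \<omega> f - G n \<omega> f) \<le> ennreal r"
          by (auto simp: not_less)
        have "sup_norm F (G n \<omega>) \<le> ennreal (4 * r)"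
        proof (rule G_bounded_off_exceptional_sets[where G="G n", OF n F less_imp_le[OF M] M'(1) r sp pos close])
          show "\<bar>G_trunc \<kappa> F M n \<omega> f\<bar> \<le> 2 * r" if "f \<in> F0" for f
            using notA that row_space(1)[OF n sp]
            unfolding A_def G_trunc_eq_centred_sum beta_def by (auto simp: not_less)
          show "weighted_excess (\<kappa> n (beta n \<omega>)) (beta n \<omega>)
              (\<lambda>x. envelope F x * indicator {x. ennreal M \<le> envelope F x} x) (snd (\<omega> n)) \<le> ennreal r"
            using notA row_space(1)[OF n sp]
            unfolding A_def h_def[abs_def] beta_def by auto
        qed
        then show False using \<omega> by (auto simp: r_def dest: leD)
      qed
      then have "outer_measure_of \<P> {\<omega> \<in> space \<P>. ennreal s < sup_norm F (G n \<omega>)}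
        \<le> outer_measure_of \<P> (({\<omega> \<in> space \<P>. \<omega> n \<in> A} \<union> ?NP) \<union> ?C)"
        by (rule outer_measure_of_mono)
      also have "\<dots> \<le> (ennreal (5 * \<eta>) + 0) + ennreal \<eta>"
        using NP PA M'(2) EA
        by (intro order.trans[OF outer_measure_of_Un_le] add_mono) auto
      also have "\<dots> = ennreal e"
        using \<eta> by (simp add: ennreal_plus[symmetric] \<eta>_def del: ennreal_plus)
      finally show ?case .
    qed
  qed
qed

end
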